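(* Let $C\subset\mathbb{P}^2(K)$ be a smooth plane sextic curve that admits a homology of period $3$ as an automorphism of maximal order (that is, $\operatorname{Aut}(C)$ contains a homology of period $3$ and every element of $\operatorname{Aut}(C)$ has order $\le3$). Up to $K$-isomorphism, $C$ is defined by an equation of the form $$Z^6+Z^3L_{3,Z}+L_{6,Z}=0,$$ where $L_{i,Z}$ is a homogeneous polynomial of degree $i$ in $X,Y$ over $K$ and neither $L_{3,Z}$ nor $L_{6,Z}$ equals $0$. Moreover, $\operatorname{Aut}(C)$ is always $\varrho_1(\mathbb{Z}/3\mathbb{Z})$ except when $C$ is $K$-isomorphic to a curve $C'$ of the form $$C':X^6+Y^6+Z^6+Z^3\left(\alpha_{3,0}X^3+\alpha_{0,3}Y^3\right)+\alpha_{3,3}X^3Y^3=0,$$ such that $\alpha_{3,0},\alpha_{0,3},\alpha_{3,3}\in K$ are pairwise distinct modulo $\{\pm1\}$ (i.e. no one of them equals $\pm$ another). In this case, $\operatorname{Aut}(C')=\varrho_1\left((\mathbb{Z}/3\mathbb{Z})^2\right)$.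
   Context: $K$ is an algebraically closed field of characteristic $p=0$ or $p>2g+1$, where $g=(d-1)(d-2)/2$ and $d=6$ (so $g=10$, $p=0$ or $p>21$). For a smooth plane curve $C:F(X,Y,Z)=0$ of degree $d\ge4$ in $\mathbb{P}^2(K)$, $\operatorname{Aut}(C)$ is regarded as the finite subgroup of $\operatorname{PGL}_3(K)$ of projective transformations preserving $C$; two smooth plane models are $K$-isomorphic iff they differ by a projective change of variables in $\operatorname{PGL}_3(K)$. $\zeta_n$ is a fixed primitive $n$-th root of unity in $K$, and $\operatorname{diag}(1,a,b)$ denotes the projective transformation $X\mapsto X,\ Y\mapsto aY,\ Z\mapsto bZ$. A homology of period $n$ is an element of $\operatorname{PGL}_3(K)$ that is $\operatorname{PGL}_3(K)$-conjugate to $\operatorname{diag}(1,1,\zeta_n)$. $\varrho_1(\mathbb{Z}/3\mathbb{Z}):=\langle\operatorname{diag}(1,1,\zeta_3)\rangle$ and $\varrho_1((\mathbb{Z}/3\mathbb{Z})^2):=\langle\operatorname{diag}(1,1,\zeta_3),\operatorname{diag}(1,\zeta_3,1)\rangle$. *)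

theory Defs
  imports
    "HOL-Analysis.Determinants"
    "HOL-Library.Poly_Mapping"
    "HOL-Computational_Algebra.Polynomial"
    "HOL-Algebra.Multiplicative_Group"
    "HOL-Algebra.Generated_Groups"
begin

section \<open>Ternary forms\<close>

text \<open>
  The polynomial ring $K[X,Y,Z]$ is the monoid algebra of the free commutative monoid on the
  three-element index type \<open>3\<close>: a monomial is its exponent vector, and multiplication of
  polynomials is the convolution provided by \<^theory>\<open>HOL-Library.Poly_Mapping\<close>.
  The indices 1, 2, 3 stand for $X$, $Y$, $Z$ (in the type \<open>3\<close> one has \<open>3 = 0\<close>,
  and 1, 2, 3 are distinct).
\<close>

type_synonym 'a poly3 = "(3 \<Rightarrow>\<^sub>0 nat) \<Rightarrow>\<^sub>0 'a"

definition Const :: "'a::field \<Rightarrow> 'a poly3"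
  where "Const c = Poly_Mapping.single 0 c"

definition Var :: "3 \<Rightarrow> 'a::field poly3"
  where "Var i = Poly_Mapping.single (Poly_Mapping.single i 1) 1"

abbreviation "varX \<equiv> Var 1"
abbreviation "varY \<equiv> Var 2"
abbreviation "varZ \<equiv> Var 3"

definition eval3 :: "'a::field poly3 \<Rightarrow> 'a^3 \<Rightarrow> 'a"
  where "eval3 F v = (\<Sum>m\<in>Poly_Mapping.keys F.
           Poly_Mapping.lookup F m * (\<Prod>i\<in>UNIV. v $ i ^ Poly_Mapping.lookup m i))"

definition pderiv3 :: "3 \<Rightarrow> 'a::field poly3 \<Rightarrow> 'a poly3"
  where "pderiv3 i F = (\<Sum>m\<in>Poly_Mapping.keys F.
           Poly_Mapping.single (m - Poly_Mapping.single i 1)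
             (of_nat (Poly_Mapping.lookup m i) * Poly_Mapping.lookup F m))"

definition homogeneous3 :: "nat \<Rightarrow> 'a::field poly3 \<Rightarrow> bool"
  where "homogeneous3 d F \<longleftrightarrow>
           (\<forall>m\<in>Poly_Mapping.keys F. (\<Sum>i\<in>UNIV. Poly_Mapping.lookup m i) = d)"

text \<open>Homogeneous of degree \<open>d\<close> in the variables $X, Y$ only (the zero polynomial is allowed).\<close>

definition binary_form_XY :: "nat \<Rightarrow> 'a::field poly3 \<Rightarrow> bool"
  where "binary_form_XY d L \<longleftrightarrow>
           homogeneous3 d L \<and> (\<forall>m\<in>Poly_Mapping.keys L. Poly_Mapping.lookup m 3 = 0)"

text \<open>
  The result of substituting $X_i \mapsto \sum_j A_{ij} X_j$ into \<open>F\<close>, so that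
  the value of \<open>lin_subst A F\<close> at \<open>v\<close> is the value of \<open>F\<close> at \<open>A *v v\<close>.
\<close>

definition lin_subst :: "'a::field^3^3 \<Rightarrow> 'a poly3 \<Rightarrow> 'a poly3"
  where "lin_subst A F = (\<Sum>m\<in>Poly_Mapping.keys F. Const (Poly_Mapping.lookup F m) *
           (\<Prod>i\<in>UNIV. (\<Sum>j\<in>UNIV. Const (A $ i $ j) * Var j) ^ Poly_Mapping.lookup m i))"

section \<open>Smooth plane curves\<close>

text \<open>
  A plane curve is given by a ternary form up to a nonzero constant factor. Over an algebraically
  closed field, smoothness means that there is no singular point in $\mathbb{P}^2(K)$. This
  excludes \<open>F = 0\<close>, for which every point is singular.
\<close>

definition smooth_plane_curve :: "nat \<Rightarrow> 'a::alg_closed_field poly3 \<Rightarrow> bool"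
  where "smooth_plane_curve d F \<longleftrightarrow> homogeneous3 d F \<and>
           \<not> (\<exists>v. v \<noteq> 0 \<and> eval3 F v = 0 \<and> (\<forall>i. eval3 (pderiv3 i F) v = 0))"

text \<open>The curves differ by a projective change of variables.\<close>

definition K_isomorphic :: "'a::field poly3 \<Rightarrow> 'a poly3 \<Rightarrow> bool"
  where "K_isomorphic F G \<longleftrightarrow>
           (\<exists>A c. invertible A \<and> c \<noteq> 0 \<and> G = Const c * lin_subst A F)"

section \<open>The projective linear group and automorphisms\<close>

definition GL3 :: "('a::field^3^3) monoid"
  where "GL3 = \<lparr>carrier = {A. invertible A}, mult = (**), one = mat 1\<rparr>"

definition scalars3 :: "('a::field^3^3) set"
  where "scalars3 = {mat c |c. c \<noteq> 0}"

definition PGL3 :: "('a::field^3^3) set monoid"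
  where "PGL3 = GL3 Mod scalars3"

definition proj_class :: "'a::field^3^3 \<Rightarrow> ('a^3^3) set"
  where "proj_class A = scalars3 #>\<^bsub>GL3\<^esub> A"

definition Aut :: "'a::field poly3 \<Rightarrow> ('a^3^3) set set"
  where "Aut F = {proj_class A |A. invertible A \<and> (\<exists>c. c \<noteq> 0 \<and> lin_subst A F = Const c * F)}"

text \<open>The projective transformation $\mathrm{diag}(1,a,b)$.\<close>

definition pdiag :: "'a::field \<Rightarrow> 'a \<Rightarrow> ('a^3^3) set"
  where "pdiag a b = proj_class (\<chi> i j. if i \<noteq> j then 0 else if i = 1 then 1 else if i = 2 then a else b)"

definition primitive_root_of_unity :: "nat \<Rightarrow> 'a::field \<Rightarrow> bool"
  where "primitive_root_of_unity n \<zeta> \<longleftrightarrow> \<zeta> ^ n = 1 \<and> (\<forall>k. 0 < k \<and> k < n \<longrightarrow> \<zeta> ^ k \<noteq> 1)"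

text \<open>If \<open>\<zeta>\<close> is a primitive \<open>n\<close>-th root of unity, these are the homologies of period \<open>n\<close>.\<close>

definition is_homology :: "'a::field \<Rightarrow> ('a^3^3) set \<Rightarrow> bool"
  where "is_homology \<zeta> \<sigma> \<longleftrightarrow>
           (\<exists>\<tau>\<in>carrier PGL3. \<sigma> = \<tau> \<otimes>\<^bsub>PGL3\<^esub> pdiag 1 \<zeta> \<otimes>\<^bsub>PGL3\<^esub> inv\<^bsub>PGL3\<^esub> \<tau>)"

definition rho1_Z3 :: "'a::field \<Rightarrow> ('a^3^3) set set"
  where "rho1_Z3 \<zeta> = generate PGL3 {pdiag 1 \<zeta>}"

definition rho1_Z3_squared :: "'a::field \<Rightarrow> ('a^3^3) set set"
  where "rho1_Z3_squared \<zeta> = generate PGL3 {pdiag 1 \<zeta>, pdiag \<zeta> 1}"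

section \<open>The two families of sextics\<close>

definition normal_sextic :: "'a::field poly3 \<Rightarrow> 'a poly3 \<Rightarrow> 'a poly3"
  where "normal_sextic L3 L6 = varZ ^ 6 + varZ ^ 3 * L3 + L6"

definition special_sextic :: "'a::field \<Rightarrow> 'a \<Rightarrow> 'a \<Rightarrow> 'a poly3"
  where "special_sextic \<alpha>30 \<alpha>03 \<alpha>33 = varX ^ 6 + varY ^ 6 + varZ ^ 6
           + varZ ^ 3 * (Const \<alpha>30 * varX ^ 3 + Const \<alpha>03 * varY ^ 3)
           + Const \<alpha>33 * varX ^ 3 * varY ^ 3"

definition pairwise_distinct_mod_sign :: "'a::field \<Rightarrow> 'a \<Rightarrow> 'a \<Rightarrow> bool"
  where "pairwise_distinct_mod_sign a b c \<longleftrightarrow>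
           a \<noteq> b \<and> a \<noteq> - b \<and> a \<noteq> c \<and> a \<noteq> - c \<and> b \<noteq> c \<and> b \<noteq> - c"

section \<open>The projective linear group is a group\<close>

lemma mat_mult_left: "mat c ** A = (\<chi> i j. c * A $ i $ j)" for A :: "'a::field^3^3"
  by (simp add: matrix_matrix_mult_def mat_def vec_eq_iff if_distrib[where f = "\<lambda>x. x * _"]
        sum.delta cong: if_cong)

lemma mat_mult_right: "A ** mat c = (\<chi> i j. c * A $ i $ j)" for A :: "'a::field^3^3"
  by (simp add: matrix_matrix_mult_def mat_def vec_eq_iff if_distrib[where f = "\<lambda>x. _ * x"]
        sum.delta mult.commute cong: if_cong)

lemma mat_mult_mat: "mat c ** mat d = (mat (c * d) :: 'a::field^3^3)"
  by (simp add: mat_mult_left) (simp add: mat_def vec_eq_iff)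

lemma invertible_mat: "c \<noteq> 0 \<Longrightarrow> invertible (mat c :: 'a::field^3^3)"
  by (auto simp: invertible_def mat_mult_mat intro!: exI[of _ "mat (inverse c)"])

lemma group_GL3: "group (GL3 :: ('a::field^3^3) monoid)"
proof (rule groupI)
  fix A :: "'a^3^3" assume "A \<in> carrier GL3"
  then obtain B where "A ** B = mat 1" "B ** A = mat 1"
    by (auto simp: GL3_def invertible_def)
  then show "\<exists>B\<in>carrier GL3. B \<otimes>\<^bsub>GL3\<^esub> A = \<one>\<^bsub>GL3\<^esub>"
    by (auto simp: GL3_def invertible_def)
qed (auto simp: GL3_def invertible_mult invertible_mat matrix_mul_assoc)

lemma normal_scalars3: "scalars3 \<lhd> (GL3 :: ('a::field^3^3) monoid)"
proof -
  interpret G: group "GL3 :: ('a^3^3) monoid" by (rule group_GL3)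
  have inv: "inv\<^bsub>GL3\<^esub> (mat c :: 'a^3^3) = mat (inverse c)" if "c \<noteq> 0" for c
    using that by (intro G.inv_equality) (auto simp: GL3_def mat_mult_mat invertible_mat)
  have "subgroup scalars3 (GL3 :: ('a^3^3) monoid)"
  proof (rule G.subgroupI)
    show "scalars3 \<noteq> ({} :: ('a^3^3) set)"
      by (auto simp: scalars3_def intro: exI[of _ 1])
    show "inv\<^bsub>GL3\<^esub> A \<in> scalars3" if "A \<in> scalars3" for A :: "'a^3^3"
      using that inv by (force simp: scalars3_def)
    show "A \<otimes>\<^bsub>GL3\<^esub> B \<in> scalars3" if "A \<in> scalars3" "B \<in> scalars3" for A B :: "'a^3^3"
      using that by (auto simp: scalars3_def GL3_def mat_mult_mat)
  qed (auto simp: scalars3_def GL3_def invertible_mat)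
  then show ?thesis
    by (intro G.normalI)
       (auto simp: r_coset_def l_coset_def GL3_def scalars3_def mat_mult_left mat_mult_right)
qed

lemma group_PGL3: "group (PGL3 :: ('a::field^3^3) set monoid)"
  unfolding PGL3_def by (rule normal.factorgroup_is_group[OF normal_scalars3])

end

theory Submission
  imports Defs
begin

text \<open>
  Write a homology of period 3 as $r = 1 + (\zeta - 1)\, p f^T$ with $f(p) = 1$, with centre $p$ and
  axis $f = 0$. If $r$ and $s = 1 + (\zeta - 1)\, q g^T$ are two of them in a group all of whose
  elements have order at most 3, then the orders of $rs$ and $rs^{-1}$ force $r = s$ or
  $f(q) = g(p) = 0$. Hence the centres of the homologies in $\mathrm{Aut}(C)$ are at most three
  independent points, which every automorphism permutes.

  If there is only one homology up to inversion, every automorphism commutes with it, has order 1 or 3,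
  and would give a second homology unless it is a power of the first. If there are two, take the
  centres as coordinate points: smoothness leaves a quadratic form in $X^3, Y^3, Z^3$, which scales to
  the special sextic. Its parameters are distinct modulo sign, as a coincidence yields an
  automorphism of order 6. Any automorphism is then a monomial matrix which preserves the squares of
  the parameters; so it is diagonal, and of order 1 or 3.
\<close>

section \<open>Evaluation, substitution and derivatives of ternary polynomials\<close>

text \<open>A bound on projective orders only says that some power is scalar, with an unknown
  factor. For products of two homologies the factor is known: the two axes meet in a common fixed
  vector, so it is 1, and the bound becomes a condition on trace and determinant on the span of the
  two centres. The equations f(q) = g(p) = 0 say that each centre lies on the axis of the other
  homology, so that both can be diagonalised at once. The vector common to both axes supplies the
  third coordinate point. The characteristic matters through 2 and 3 being nonzero: a transvection
  would otherwise have order 2 or 3 and escape the bound. Order 6 is the recurring obstruction. It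
  arises when a homology of period 3 meets an involution commuting with it: a sign change of Z if
  the cubic coefficient vanishes, or a swap of coordinates if two parameters agree up to sign.
  Parameters are compared modulo sign because replacing X by -X flips two of the three.\<close>

lemma prod_3: "prod f (UNIV :: 3 set) = f 1 * f 2 * f 3"
  unfolding UNIV_3 by (simp add: ac_simps)

lemma poly3_eq_sum_single:
  fixes F :: "'a::field poly3"
  assumes "finite S" "Poly_Mapping.keys F \<subseteq> S"
  shows "F = (\<Sum>m\<in>S. Poly_Mapping.single m (Poly_Mapping.lookup F m))"
proof (rule poly_mapping_eqI)
  fix k
  have "Poly_Mapping.lookup (\<Sum>m\<in>S. Poly_Mapping.single m (Poly_Mapping.lookup F m)) k
      = (\<Sum>m\<in>S. Poly_Mapping.lookup (Poly_Mapping.single m (Poly_Mapping.lookup F m)) k)"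
    by (simp add: lookup_sum)
  also have "\<dots> = (\<Sum>m\<in>S. if k = m then Poly_Mapping.lookup F m else 0)"
    by (intro sum.cong) (auto simp: lookup_single when_def)
  also have "\<dots> = Poly_Mapping.lookup F k"
    using assms by (auto simp: in_keys_iff)
  finally show "Poly_Mapping.lookup F k =
      Poly_Mapping.lookup (\<Sum>m\<in>S. Poly_Mapping.single m (Poly_Mapping.lookup F m)) k" by simp
qed

lemma poly3_single_induct [case_names single add]:
  fixes F :: "'a::field poly3"
  assumes "\<And>m a. P (Poly_Mapping.single m a)"
    and "\<And>F G. P F \<Longrightarrow> P G \<Longrightarrow> P (F + G)"
  shows "P F"
proof -
  have "P (\<Sum>m\<in>S. Poly_Mapping.single m (Poly_Mapping.lookup F m))" if "finite S" for S
    using that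
  proof induction
    case empty
    show ?case using assms(1)[of 0 0] by simp
  next
    case (insert m S)
    then show ?case using assms by simp
  qed
  from this[of "Poly_Mapping.keys F"] show ?thesis
    using poly3_eq_sum_single[of "Poly_Mapping.keys F" F] by simp
qed

text \<open>Both \<open>eval3\<close> and \<open>lin_subst\<close> are instances of the following evaluation map.\<close>

definition poly_ev :: "('a::field \<Rightarrow> 'b::comm_ring_1) \<Rightarrow> (3 \<Rightarrow> 'b) \<Rightarrow> 'a poly3 \<Rightarrow> 'b"
  where "poly_ev h x F = (\<Sum>m\<in>Poly_Mapping.keys F.
           h (Poly_Mapping.lookup F m) * (\<Prod>i\<in>UNIV. x i ^ Poly_Mapping.lookup m i))"

locale coeff_hom =
  fixes h :: "'a::field \<Rightarrow> 'b::comm_ring_1"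
  assumes h_add: "h (a + b) = h a + h b"
    and h_mult: "h (a * b) = h a * h b"
    and h_1: "h 1 = 1"
begin

lemma h_0: "h 0 = 0"
  using h_add[of 0 0] by simp

text \<open>Cancellation can make the keys of a sum smaller than the union of the keys. Sums over
  keys are therefore extended to a common finite set; the additional terms vanish because
  \<open>h 0 = 0\<close>.\<close>

lemma poly_ev_superset:
  assumes "finite S" "Poly_Mapping.keys F \<subseteq> S"
  shows "poly_ev h x F
    = (\<Sum>m\<in>S. h (Poly_Mapping.lookup F m) * (\<Prod>i\<in>UNIV. x i ^ Poly_Mapping.lookup m i))"
  unfolding poly_ev_def using assms
  by (intro sum.mono_neutral_left) (auto simp: in_keys_iff h_0)

lemma poly_ev_add: "poly_ev h x (F + G) = poly_ev h x F + poly_ev h x G"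
proof -
  let ?S = "Poly_Mapping.keys F \<union> Poly_Mapping.keys G"
  have "Poly_Mapping.keys (F + G) \<subseteq> ?S" by (rule Poly_Mapping.keys_add)
  then show ?thesis
    using poly_ev_superset[of ?S "F + G"] poly_ev_superset[of ?S F] poly_ev_superset[of ?S G]
    by (simp add: lookup_add h_add distrib_right sum.distrib)
qed

lemma poly_ev_single:
  "poly_ev h x (Poly_Mapping.single m a) = h a * (\<Prod>i\<in>UNIV. x i ^ Poly_Mapping.lookup m i)"
  by (subst poly_ev_superset[where S = "{m}"]) auto

lemma poly_ev_mult: "poly_ev h x (F * G) = poly_ev h x F * poly_ev h x G"
proof (induction F rule: poly3_single_induct)
  case (single m a)
  show ?case
  proof (induction G rule: poly3_single_induct)
    case (single n b)
    show ?case
      by (simp add: mult_single poly_ev_single h_mult lookup_add power_add prod.distrib mult_ac)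
  next
    case (add F G)
    then show ?case by (simp add: poly_ev_add distrib_left)
  qed
next
  case (add F G)
  then show ?case by (simp add: poly_ev_add distrib_right)
qed

lemma poly_ev_Const: "poly_ev h x (Const a) = h a"
  by (simp add: Const_def poly_ev_single)

lemma poly_ev_Var: "poly_ev h x (Var i) = x i"
proof -
  have "(\<Prod>j\<in>UNIV. x j ^ Poly_Mapping.lookup (Poly_Mapping.single i 1) j)
      = (\<Prod>j\<in>UNIV. if j = i then x j else 1)"
    by (intro prod.cong) (auto simp: lookup_single when_def)
  then show ?thesis
    by (simp add: Var_def poly_ev_single h_1)
qed

lemma poly_ev_0: "poly_ev h x 0 = 0"
  by (simp add: poly_ev_def)

lemma poly_ev_1: "poly_ev h x 1 = 1"
  using poly_ev_Const[of x 1] by (simp add: Const_def h_1)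

lemma poly_ev_power: "poly_ev h x (F ^ n) = poly_ev h x F ^ n"
  by (induction n) (simp_all add: poly_ev_1 poly_ev_mult)

lemma poly_ev_sum: "poly_ev h x (\<Sum>s\<in>S. G s) = (\<Sum>s\<in>S. poly_ev h x (G s))"
  by (induction S rule: infinite_finite_induct) (simp_all add: poly_ev_0 poly_ev_add)

lemma poly_ev_prod: "poly_ev h x (\<Prod>s\<in>S. G s) = (\<Prod>s\<in>S. poly_ev h x (G s))"
  by (induction S rule: infinite_finite_induct) (simp_all add: poly_ev_1 poly_ev_mult)

end

lemma Const_add: "Const (a + b) = Const a + Const b"
  by (simp add: Const_def single_add)

lemma Const_mult: "Const (a * b) = Const a * Const b"
  by (simp add: Const_def mult_single)

lemma Const_0 [simp]: "Const 0 = 0"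
  by (simp add: Const_def)

lemma Const_1 [simp]: "Const 1 = 1"
  by (simp add: Const_def)

lemma Const_power: "Const (a ^ n) = Const a ^ n"
  by (induction n) (simp_all add: Const_mult)

lemma Const_prod: "Const (\<Prod>s\<in>S. f s) = (\<Prod>s\<in>S. Const (f s))"
  by (induction S rule: infinite_finite_induct) (simp_all add: Const_mult)

interpretation subst_hom: coeff_hom Const
  by unfold_locales (simp_all add: Const_add Const_mult)

interpretation eval_hom: coeff_hom "\<lambda>a. a"
  by unfold_locales simp_all

lemma lin_subst_eq: "lin_subst A = poly_ev Const (\<lambda>i. \<Sum>j\<in>UNIV. Const (A $ i $ j) * Var j)"
  by (simp add: fun_eq_iff lin_subst_def poly_ev_def)

lemma eval3_eq: "eval3 F v = poly_ev (\<lambda>a. a) (\<lambda>i. v $ i) F"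
  by (simp add: eval3_def poly_ev_def)

lemmas lin_subst_add = subst_hom.poly_ev_add[where x = "\<lambda>i. \<Sum>j\<in>UNIV. Const (A $ i $ j) * Var j" for A,
    folded lin_subst_eq]
lemmas lin_subst_mult = subst_hom.poly_ev_mult[where x = "\<lambda>i. \<Sum>j\<in>UNIV. Const (A $ i $ j) * Var j" for A,
    folded lin_subst_eq]
lemmas lin_subst_sum = subst_hom.poly_ev_sum[where x = "\<lambda>i. \<Sum>j\<in>UNIV. Const (A $ i $ j) * Var j" for A,
    folded lin_subst_eq]
lemmas lin_subst_prod = subst_hom.poly_ev_prod[where x = "\<lambda>i. \<Sum>j\<in>UNIV. Const (A $ i $ j) * Var j" for A,
    folded lin_subst_eq]
lemmas lin_subst_power = subst_hom.poly_ev_power[where x = "\<lambda>i. \<Sum>j\<in>UNIV. Const (A $ i $ j) * Var j" for A,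
    folded lin_subst_eq]
lemmas lin_subst_Const = subst_hom.poly_ev_Const[where x = "\<lambda>i. \<Sum>j\<in>UNIV. Const (A $ i $ j) * Var j" for A,
    folded lin_subst_eq]
lemmas lin_subst_Var = subst_hom.poly_ev_Var[where x = "\<lambda>i. \<Sum>j\<in>UNIV. Const (A $ i $ j) * Var j" for A,
    folded lin_subst_eq]

lemmas eval3_add = eval_hom.poly_ev_add[where x = "\<lambda>i. v $ i" for v, folded eval3_eq]
lemmas eval3_mult = eval_hom.poly_ev_mult[where x = "\<lambda>i. v $ i" for v, folded eval3_eq]
lemmas eval3_sum = eval_hom.poly_ev_sum[where x = "\<lambda>i. v $ i" for v, folded eval3_eq]
lemmas eval3_prod = eval_hom.poly_ev_prod[where x = "\<lambda>i. v $ i" for v, folded eval3_eq]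
lemmas eval3_power = eval_hom.poly_ev_power[where x = "\<lambda>i. v $ i" for v, folded eval3_eq]
lemmas eval3_Const = eval_hom.poly_ev_Const[where x = "\<lambda>i. v $ i" for v, folded eval3_eq]
lemmas eval3_Var = eval_hom.poly_ev_Var[where x = "\<lambda>i. v $ i" for v, folded eval3_eq]
lemmas eval3_single = eval_hom.poly_ev_single[where x = "\<lambda>i. v $ i" for v, folded eval3_eq]
lemmas eval3_simps = eval3_add eval3_mult eval3_sum eval3_prod eval3_power eval3_Const eval3_Var
lemmas lin_subst_simps = lin_subst_add lin_subst_mult lin_subst_sum lin_subst_prod lin_subst_power
  lin_subst_Const lin_subst_Var

lemma single_eq_Const_mult:
  "Poly_Mapping.single m a = Const a * (\<Prod>i\<in>UNIV. Var i ^ Poly_Mapping.lookup m i)"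
proof -
  have pow: "Var i ^ k = (Poly_Mapping.single (Poly_Mapping.single i k) 1 :: 'a poly3)" for i k
    by (induction k) (simp_all add: Var_def mult_single flip: single_add)
  have m: "m = Poly_Mapping.single 1 (Poly_Mapping.lookup m 1) + Poly_Mapping.single 2 (Poly_Mapping.lookup m 2)
      + Poly_Mapping.single 3 (Poly_Mapping.lookup m 3)"
    by (rule poly_mapping_eqI) (use exhaust_3 in \<open>auto simp: lookup_add lookup_single when_def\<close>)
  have "(\<Prod>i\<in>UNIV. Var i ^ Poly_Mapping.lookup m i) = (Poly_Mapping.single m 1 :: 'a poly3)"
    using arg_cong[OF m, of "\<lambda>m. Poly_Mapping.single m (1::'a)"]
    by (simp add: prod_3 pow mult_single del: One_nat_def)
  then show ?thesis
    by (simp add: Const_def mult_single)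
qed

text \<open>Constants and variables generate the ring. For statements compatible with sums and
  products, such as composition of substitutions or the chain rule, only the generators remain to be
  checked.\<close>

lemma poly3_induct [case_names Const Var add mult]:
  fixes F :: "'a::field poly3"
  assumes "\<And>a. P (Const a)" "\<And>i. P (Var i)"
    and "\<And>F G. P F \<Longrightarrow> P G \<Longrightarrow> P (F + G)"
    and "\<And>F G. P F \<Longrightarrow> P G \<Longrightarrow> P (F * G)"
  shows "P F"
proof (induction F rule: poly3_single_induct)
  case (single m a)
  have 1: "P 1" using assms(1)[of 1] by simp
  have pow: "P (Var i ^ k)" for i k
    by (induction k) (simp_all add: 1 assms)
  show ?case
    unfolding single_eq_Const_mult by (simp add: prod_3 assms pow)
qed (rule assms(3))

text \<open>The order reverses because substitution is precomposition: the value at v is that of F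
  at \<open>B *v (A *v v)\<close>.\<close>

lemma lin_subst_lin_subst: "lin_subst A (lin_subst B F) = lin_subst (B ** A) F"
proof (induction F rule: poly3_induct)
  case (Var i)
  show ?case
    by (simp add: lin_subst_simps matrix_matrix_mult_def Const_mult Const_add sum_3 algebra_simps)
qed (simp_all add: lin_subst_simps)

lemma lin_subst_mat_1 [simp]: "lin_subst (mat 1) F = F"
proof (induction F rule: poly3_induct)
  case (Var i)
  show ?case
    using exhaust_3[of i] by (auto simp: lin_subst_simps mat_def sum_3)
qed (simp_all add: lin_subst_simps)

lemma eval3_lin_subst: "eval3 (lin_subst A F) v = eval3 F (A *v v)"
  by (induction F rule: poly3_induct)
    (simp_all add: lin_subst_simps eval3_simps matrix_vector_mult_def)

lemma lookup_Const_mult: "Poly_Mapping.lookup (Const c * F) m = c * Poly_Mapping.lookup F m"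
proof (induction F rule: poly3_single_induct)
  case (single n a)
  show ?case by (simp add: Const_def mult_single lookup_single when_def)
qed (simp add: distrib_left lookup_add)

section \<open>Partial derivatives: product rule and chain rule\<close>

lemma pderiv3_superset:
  assumes "finite S" "Poly_Mapping.keys F \<subseteq> S"
  shows "pderiv3 i F = (\<Sum>m\<in>S. Poly_Mapping.single (m - Poly_Mapping.single i 1)
             (of_nat (Poly_Mapping.lookup m i) * Poly_Mapping.lookup F m))"
  unfolding pderiv3_def using assms
  by (intro sum.mono_neutral_left) (auto simp: in_keys_iff)

lemma pderiv3_add: "pderiv3 i (F + G) = pderiv3 i F + pderiv3 i G"
proof -
  let ?S = "Poly_Mapping.keys F \<union> Poly_Mapping.keys G"
  have "Poly_Mapping.keys (F + G) \<subseteq> ?S" by (rule Poly_Mapping.keys_add)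
  then show ?thesis
    using pderiv3_superset[of ?S "F + G"] pderiv3_superset[of ?S F] pderiv3_superset[of ?S G]
    by (simp add: lookup_add distrib_left sum.distrib single_add)
qed

lemma pderiv3_single: "pderiv3 i (Poly_Mapping.single m a)
    = Poly_Mapping.single (m - Poly_Mapping.single i 1) (of_nat (Poly_Mapping.lookup m i) * a)"
  by (subst pderiv3_superset[where S = "{m}"]) auto

lemma pderiv3_mult: "pderiv3 i (F * G) = pderiv3 i F * G + F * pderiv3 i G"
proof (induction F rule: poly3_single_induct)
  case (single m a)
  show ?case
  proof (induction G rule: poly3_single_induct)
    case (single n b)
    \<comment> \<open>Subtraction of exponents truncates at 0, so this identity needs a positive
      exponent in m. If the exponent is 0, the coefficient \<open>of_nat 0\<close> removes the
      term.\<close>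
    have *: "m + n - Poly_Mapping.single i 1 = (m - Poly_Mapping.single i 1) + n"
      if "Poly_Mapping.lookup m i > 0" for m n :: "3 \<Rightarrow>\<^sub>0 nat"
      using that by (intro poly_mapping_eqI) (auto simp: lookup_add lookup_minus lookup_single when_def)
    have m: "Poly_Mapping.single (m + n - Poly_Mapping.single i 1) (of_nat (Poly_Mapping.lookup m i) * a * b)
       = Poly_Mapping.single ((m - Poly_Mapping.single i 1) + n) (of_nat (Poly_Mapping.lookup m i) * a * b)"
      by (cases "Poly_Mapping.lookup m i = 0") (simp_all add: * del: One_nat_def)
    have n: "Poly_Mapping.single (m + n - Poly_Mapping.single i 1) (a * (of_nat (Poly_Mapping.lookup n i) * b))
       = Poly_Mapping.single (m + (n - Poly_Mapping.single i 1)) (a * (of_nat (Poly_Mapping.lookup n i) * b))"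
      using *[of n m] by (cases "Poly_Mapping.lookup n i = 0") (simp_all add: add.commute del: One_nat_def)
    show ?case
      unfolding pderiv3_single mult_single m[symmetric] n[symmetric] single_add[symmetric]
      by (simp add: lookup_add algebra_simps)
  next
    case (add F G)
    then show ?case by (simp add: pderiv3_add algebra_simps)
  qed
next
  case (add F G)
  then show ?case by (simp add: pderiv3_add algebra_simps)
qed

lemma pderiv3_Const: "pderiv3 i (Const a) = 0"
  by (simp add: Const_def pderiv3_single)

lemma pderiv3_Var: "pderiv3 i (Var j) = (if i = j then 1 else 0)"
  by (simp add: Var_def pderiv3_single lookup_single)

text \<open>The chain rule: the gradient is transformed by the transpose of A. It is what makes
  smoothness independent of coordinates.\<close>

lemma pderiv3_lin_subst:
  "pderiv3 i (lin_subst A F) = (\<Sum>j\<in>UNIV. Const (A $ j $ i) * lin_subst A (pderiv3 j F))"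
proof (induction F rule: poly3_induct)
  case (Const a)
  have "lin_subst A 0 = 0" using lin_subst_Const[of A 0] by simp
  then show ?case by (simp add: lin_subst_simps pderiv3_Const)
next
  case (Var k)
  have z: "lin_subst A 0 = 0" using lin_subst_Const[of A 0] by simp
  have o: "lin_subst A 1 = 1" using lin_subst_Const[of A 1] by simp
  show ?case
    using exhaust_3[of i] exhaust_3[of k]
    by (auto simp: lin_subst_simps pderiv3_add sum_3 pderiv3_mult pderiv3_Const pderiv3_Var z o)
next
  case (add F G)
  then show ?case by (simp add: lin_subst_simps pderiv3_add sum.distrib distrib_left)
next
  case (mult F G)
  then show ?case
    by (simp add: lin_subst_simps pderiv3_mult sum_3 algebra_simps)
qed

section \<open>Homogeneous forms\<close>

lemma homogeneous3_add: "homogeneous3 d F \<Longrightarrow> homogeneous3 d G \<Longrightarrow> homogeneous3 d (F + G)"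
  using Poly_Mapping.keys_add[of F G] by (auto simp: homogeneous3_def)

lemma homogeneous3_mult:
  assumes "homogeneous3 d F" "homogeneous3 e G"
  shows "homogeneous3 (d + e) (F * G)"
  unfolding homogeneous3_def
proof
  fix m assume "m \<in> Poly_Mapping.keys (F * G)"
  then obtain a b where "m = a + b" "a \<in> Poly_Mapping.keys F" "b \<in> Poly_Mapping.keys G"
    using keys_mult[of F G] by auto
  then show "(\<Sum>i\<in>UNIV. Poly_Mapping.lookup m i) = d + e"
    using assms by (simp add: homogeneous3_def lookup_add sum.distrib)
qed

lemma homogeneous3_Const: "homogeneous3 0 (Const a)"
  by (simp add: homogeneous3_def Const_def)

lemma homogeneous3_Var: "homogeneous3 1 (Var i)"
  by (simp add: homogeneous3_def Var_def lookup_single when_def)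

lemma homogeneous3_power: "homogeneous3 d F \<Longrightarrow> homogeneous3 (k * d) (F ^ k)"
  using homogeneous3_mult homogeneous3_Const[of 1] by (induction k) auto

lemma homogeneous3_0 [simp]: "homogeneous3 d 0"
  by (simp add: homogeneous3_def)

lemma homogeneous3_sum:
  "(\<And>s. s \<in> S \<Longrightarrow> homogeneous3 d (G s)) \<Longrightarrow> homogeneous3 d (\<Sum>s\<in>S. G s)"
  by (induction S rule: infinite_finite_induct) (auto simp: homogeneous3_add)

lemma homogeneous3_lin_subst:
  assumes "homogeneous3 d F"
  shows "homogeneous3 d (lin_subst A F)"
  unfolding lin_subst_def
proof (rule homogeneous3_sum)
  fix m assume m: "m \<in> Poly_Mapping.keys F"
  let ?l = "\<lambda>i. \<Sum>j\<in>UNIV. Const (A $ i $ j) * Var j"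
  have l: "homogeneous3 1 (?l i)" for i
    using homogeneous3_mult[OF homogeneous3_Const homogeneous3_Var] by (intro homogeneous3_sum) auto
  have p: "homogeneous3 k (?l i ^ k)" for i k
    using homogeneous3_power[OF l, of k i] by simp
  have "homogeneous3 (Poly_Mapping.lookup m 1 + (Poly_Mapping.lookup m 2 + Poly_Mapping.lookup m 3))
      (\<Prod>i\<in>UNIV. ?l i ^ Poly_Mapping.lookup m i)"
    using homogeneous3_mult[OF p homogeneous3_mult[OF p p]] by (simp only: prod_3 mult.assoc)
  moreover have "d = 0 + (Poly_Mapping.lookup m 1 + (Poly_Mapping.lookup m 2 + Poly_Mapping.lookup m 3))"
    using assms m by (auto simp: homogeneous3_def sum_3)
  ultimately show "homogeneous3 d (Const (Poly_Mapping.lookup F m) *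
           (\<Prod>i\<in>UNIV. ?l i ^ Poly_Mapping.lookup m i))"
    using homogeneous3_mult[OF homogeneous3_Const] by blast
qed

section \<open>Automorphism matrices and the projective linear group\<close>

definition diag3 :: "(3 \<Rightarrow> 'a::field) \<Rightarrow> 'a^3^3"
  where "diag3 d = (\<chi> i j. if i = j then d i else 0)"

lemma diag3_nth [simp]: "diag3 d $ i $ j = (if i = j then d i else 0)"
  by (simp add: diag3_def)

lemma diag3_mult: "diag3 d ** diag3 e = diag3 (\<lambda>i. d i * e i)"
  by (simp add: matrix_matrix_mult_def vec_eq_iff if_distrib[where f = "\<lambda>x. x * _"]
        sum.delta cong: if_cong)

lemma mat_eq_diag3: "mat c = diag3 (\<lambda>_. c)"
  by (simp add: mat_def diag3_def)

lemma diag3_eq_iff: "diag3 d = diag3 e \<longleftrightarrow> (\<forall>i. d i = e i)"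
  by (auto simp: vec_eq_iff)

lemma invertible_diag3:
  assumes "\<And>i. d i \<noteq> 0"
  shows "invertible (diag3 d)"
  unfolding invertible_def
  by (rule exI[of _ "diag3 (\<lambda>i. inverse (d i))"])
    (use assms in \<open>simp add: diag3_mult mat_eq_diag3\<close>)

lemma invertible_diag3_iff: "invertible (diag3 d) \<longleftrightarrow> (\<forall>i. d i \<noteq> 0)"
proof
  assume "invertible (diag3 d)"
  then obtain B where B: "diag3 d ** B = mat 1"
    by (auto simp: invertible_def)
  show "\<forall>i. d i \<noteq> 0"
  proof (intro allI notI)
    fix i assume "d i = 0"
    then have "(diag3 d ** B) $ i $ i = 0"
      by (simp add: matrix_matrix_mult_def if_distrib[where f = "\<lambda>x. x * _"] cong: if_cong)
    then show False by (simp add: B mat_def)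
  qed
qed (simp add: invertible_diag3)

lemma lin_subst_diag3_Var: "lin_subst (diag3 d) (Var i) = Const (d i) * Var i"
  using exhaust_3[of i] by (auto simp: lin_subst_simps sum_3)

text \<open>A diagonal substitution has the monomials as eigenvectors. Invariance of a form thus
  turns into conditions on the exponents of its monomials.\<close>

lemma lookup_lin_subst_diag3:
  "Poly_Mapping.lookup (lin_subst (diag3 d) F) m
    = (\<Prod>i\<in>UNIV. d i ^ Poly_Mapping.lookup m i) * Poly_Mapping.lookup F m"
proof (induction F rule: poly3_single_induct)
  case (single n a)
  have "lin_subst (diag3 d) (Poly_Mapping.single n a)
      = Const (\<Prod>i\<in>UNIV. d i ^ Poly_Mapping.lookup n i) * Poly_Mapping.single n a"
    by (simp add: single_eq_Const_mult lin_subst_mult lin_subst_prod lin_subst_power lin_subst_Const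
        lin_subst_diag3_Var power_mult_distrib prod.distrib Const_prod Const_power mult_ac)
  then show ?case
    by (simp add: lookup_Const_mult lookup_single when_def)
next
  case (add F G)
  then show ?case by (simp add: lin_subst_simps lookup_add distrib_left)
qed

lemma lin_subst_scalar:
  assumes "homogeneous3 d F"
  shows "lin_subst (mat s) F = Const (s ^ d) * F"
proof (rule poly_mapping_eqI)
  fix m
  show "Poly_Mapping.lookup (lin_subst (mat s) F) m = Poly_Mapping.lookup (Const (s ^ d) * F) m"
    using assms
    by (cases "m \<in> Poly_Mapping.keys F")
      (auto simp: mat_eq_diag3 lookup_lin_subst_diag3 lookup_Const_mult homogeneous3_def
        power_sum[symmetric] in_keys_iff)
qed

text \<open>Representatives of the classes in \<open>Aut F\<close>, so that the computations take
  place with matrices.\<close>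

definition aut_matrix :: "'a::field poly3 \<Rightarrow> 'a^3^3 \<Rightarrow> bool"
  where "aut_matrix F A \<longleftrightarrow> invertible A \<and> (\<exists>c. c \<noteq> 0 \<and> lin_subst A F = Const c * F)"

lemma Aut_eq: "Aut F = proj_class ` {A. aut_matrix F A}"
  by (auto simp: Aut_def aut_matrix_def)

lemma aut_matrix_mult:
  assumes "aut_matrix F A" "aut_matrix F B"
  shows "aut_matrix F (A ** B)"
proof -
  obtain c d where c: "c \<noteq> 0" "lin_subst A F = Const c * F"
    and d: "d \<noteq> 0" "lin_subst B F = Const d * F"
    using assms by (auto simp: aut_matrix_def)
  have "lin_subst (A ** B) F = Const (c * d) * F"
    by (simp add: c d lin_subst_simps Const_mult flip: lin_subst_lin_subst)
  then show ?thesis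
    using assms c d by (auto simp: aut_matrix_def invertible_mult intro!: exI[of _ "c * d"])
qed

lemma aut_matrix_inverse:
  assumes "aut_matrix F A" "A ** B = mat 1"
  shows "aut_matrix F B"
proof -
  obtain c where c: "c \<noteq> 0" "lin_subst A F = Const c * F"
    using assms by (auto simp: aut_matrix_def)
  have "F = lin_subst B (lin_subst A F)"
    by (simp add: lin_subst_lin_subst assms)
  then have "F = Const c * lin_subst B F"
    by (simp add: c lin_subst_simps)
  then have "Const (inverse c) * F = Const (inverse c * c) * lin_subst B F"
    by (metis Const_mult mult.assoc)
  then have "lin_subst B F = Const (inverse c) * F"
    using c by simp
  moreover have "invertible B"
    using assms matrix_left_right_inverse by (auto simp: invertible_def)
  ultimately show ?thesis
    using c by (auto simp: aut_matrix_def intro!: exI[of _ "inverse c"])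
qed

lemma aut_matrix_scalar:
  assumes "homogeneous3 d F" "s \<noteq> 0"
  shows "aut_matrix F (mat s)"
  using assms by (auto simp: aut_matrix_def invertible_mat lin_subst_scalar intro!: exI[of _ "s ^ d"])

lemma K_isomorphic_trans:
  assumes "K_isomorphic F G" "K_isomorphic G H"
  shows "K_isomorphic F H"
proof -
  obtain A c B d where A: "invertible A" "c \<noteq> 0" "G = Const c * lin_subst A F"
    and B: "invertible B" "d \<noteq> 0" "H = Const d * lin_subst B G"
    using assms by (auto simp: K_isomorphic_def)
  have "H = Const (d * c) * lin_subst (A ** B) F"
    by (simp add: A B lin_subst_simps lin_subst_lin_subst Const_mult mult_ac)
  then show ?thesis
    using A B by (auto simp: K_isomorphic_def invertible_mult intro!: exI[of _ "A ** B"] exI[of _ "d * c"])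
qed

text \<open>A singular point v of G gives the singular point \<open>A *v v\<close> of F: by the
  chain rule the gradient w of F there satisfies \<open>w v* A = 0\<close>, and A is
  invertible.\<close>

lemma smooth_plane_curve_K_isomorphic:
  assumes "smooth_plane_curve d F" "K_isomorphic F G"
  shows "smooth_plane_curve d G"
proof -
  obtain A c where A: "invertible A" "c \<noteq> 0" "G = Const c * lin_subst A F"
    using assms by (auto simp: K_isomorphic_def)
  have hom: "homogeneous3 d F"
    and sm: "\<And>v. v \<noteq> 0 \<Longrightarrow> eval3 F v = 0 \<Longrightarrow> \<exists>i. eval3 (pderiv3 i F) v \<noteq> 0"
    using assms by (auto simp: smooth_plane_curve_def)
  have "homogeneous3 d G"
    using homogeneous3_mult[OF homogeneous3_Const homogeneous3_lin_subst[OF hom]] A by simp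
  moreover have False if v: "v \<noteq> 0" "eval3 G v = 0" "\<forall>i. eval3 (pderiv3 i G) v = 0" for v
  proof -
    obtain B where B: "A ** B = mat 1" "B ** A = mat 1"
      using A by (auto simp: invertible_def)
    define w where "w = (\<chi> j. eval3 (pderiv3 j F) (A *v v))"
    have "A *v v \<noteq> 0"
      using v B by (metis matrix_vector_mul_assoc matrix_vector_mul_lid matrix_vector_mult_0_right)
    moreover have "eval3 F (A *v v) = 0"
      using v A by (simp add: eval3_simps eval3_lin_subst)
    ultimately have "w \<noteq> 0"
      using sm by (force simp: w_def vec_eq_iff)
    have "w v* A = 0"
    proof (rule vec_eq_iff[THEN iffD2], intro allI)
      fix i
      have "eval3 (pderiv3 i G) v = c * (w v* A) $ i"
        by (simp add: A pderiv3_mult pderiv3_Const pderiv3_lin_subst eval3_simps eval3_lin_subst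
            w_def vector_matrix_mult_def mult.commute)
      then show "(w v* A) $ i = 0 $ i" using v A by simp
    qed
    then have "(w v* A) v* B = 0"
      by (simp add: vector_matrix_mult_def vec_eq_iff)
    then show False
      using \<open>w \<noteq> 0\<close> by (simp add: vector_matrix_mul_assoc B vector_matrix_mul_rid)
  qed
  ultimately show ?thesis
    by (auto simp: smooth_plane_curve_def)
qed

definition is_scalar :: "'a::field^3^3 \<Rightarrow> bool"
  where "is_scalar A \<longleftrightarrow> (\<exists>s. A = mat s)"

text \<open>The order bound in terms of representatives: a power of a class is trivial exactly if
  the power of the matrix is scalar.\<close>

definition aut_orders_le_3 :: "'a::field poly3 \<Rightarrow> bool"
  where "aut_orders_le_3 F \<longleftrightarrow>
    (\<forall>A. aut_matrix F A \<longrightarrow> is_scalar A \<or> is_scalar (A ** A) \<or> is_scalar (A ** A ** A))"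

lemma is_scalar_conj:
  assumes "is_scalar (P ** A ** Q)" "Q ** P = mat 1"
  shows "is_scalar A"
proof -
  obtain s where s: "P ** A ** Q = mat s"
    using assms by (auto simp: is_scalar_def)
  have "P ** Q = mat 1"
    using assms matrix_left_right_inverse by blast
  have "A = Q ** P ** A ** (Q ** P)"
    by (simp add: assms)
  also have "\<dots> = Q ** (P ** A ** Q) ** P"
    by (simp add: matrix_mul_assoc)
  also have "\<dots> = mat s ** (Q ** P)"
    by (simp add: s mat_mult_right matrix_mul_assoc flip: mat_mult_left)
  finally show ?thesis
    using assms by (auto simp: is_scalar_def)
qed

lemma aut_matrix_conj:
  assumes "aut_matrix (Const c * lin_subst P F) B" "c \<noteq> 0" "P ** Q = mat 1"
  shows "aut_matrix F (P ** B ** Q)"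
proof -
  obtain e where e: "e \<noteq> 0" "lin_subst B (Const c * lin_subst P F) = Const e * (Const c * lin_subst P F)"
    and B: "invertible B"
    using assms by (auto simp: aut_matrix_def)
  have QP: "Q ** P = mat 1"
    using assms matrix_left_right_inverse by blast
  have "Const (inverse c) * (Const c * lin_subst B (lin_subst P F))
      = Const (inverse c) * (Const e * (Const c * lin_subst P F))"
    using e by (simp add: lin_subst_simps)
  then have "Const (inverse c * c) * lin_subst B (lin_subst P F) = Const (inverse c * c) * (Const e * lin_subst P F)"
    by (simp add: Const_mult mult_ac)
  then have "lin_subst B (lin_subst P F) = Const e * lin_subst P F"
    using assms by simp
  then have "lin_subst Q (lin_subst B (lin_subst P F)) = Const e * lin_subst Q (lin_subst P F)"
    by (simp add: lin_subst_simps)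
  then have "lin_subst (P ** B ** Q) F = Const e * F"
    using assms by (simp add: lin_subst_lin_subst)
  moreover have "invertible (P ** B ** Q)"
    using B QP assms by (intro invertible_mult) (auto simp: invertible_def)
  ultimately show ?thesis
    using e by (auto simp: aut_matrix_def)
qed

lemma aut_orders_le_3_K_isomorphic:
  assumes "aut_orders_le_3 F" "K_isomorphic F G"
  shows "aut_orders_le_3 G"
  unfolding aut_orders_le_3_def
proof (intro allI impI)
  fix B assume B: "aut_matrix G B"
  obtain P Q c where P: "c \<noteq> 0" "G = Const c * lin_subst P F" "P ** Q = mat 1" "Q ** P = mat 1"
    using assms by (auto simp: K_isomorphic_def invertible_def)
  have QP: "X ** Q ** P = X" for X
    using P by (simp flip: matrix_mul_assoc)
  let ?C = "P ** B ** Q"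
  have "aut_matrix F ?C"
    using aut_matrix_conj P B by blast
  then have "is_scalar ?C \<or> is_scalar (?C ** ?C) \<or> is_scalar (?C ** ?C ** ?C)"
    using assms by (auto simp: aut_orders_le_3_def)
  moreover have "?C ** ?C = P ** (B ** B) ** Q" "?C ** ?C ** ?C = P ** (B ** B ** B) ** Q"
    by (simp_all add: matrix_mul_assoc QP)
  ultimately show "is_scalar B \<or> is_scalar (B ** B) \<or> is_scalar (B ** B ** B)"
    using is_scalar_conj P by metis
qed

section \<open>Classes of matrices in the projective linear group\<close>

lemma proj_class_eq: "proj_class A = {mat s ** A |s. s \<noteq> 0}"
  by (auto simp: proj_class_def r_coset_def scalars3_def GL3_def)

lemma proj_class_eq_iff: "proj_class A = proj_class B \<longleftrightarrow> (\<exists>s. s \<noteq> 0 \<and> A = mat s ** B)"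
proof
  assume "proj_class A = proj_class B"
  moreover have "A \<in> proj_class A"
    unfolding proj_class_eq using matrix_mul_lid[of A] by (metis (mono_tags, lifting) mem_Collect_eq zero_neq_one)
  ultimately show "\<exists>s. s \<noteq> 0 \<and> A = mat s ** B"
    by (auto simp: proj_class_eq)
next
  assume "\<exists>s. s \<noteq> 0 \<and> A = mat s ** B"
  then obtain s where s: "s \<noteq> 0" "A = mat s ** B" by blast
  have "mat t ** B = mat (t / s) ** A" for t
    using s by (simp add: matrix_mul_assoc mat_mult_mat)
  then show "proj_class A = proj_class B"
    using s unfolding proj_class_eq
    by (auto simp: matrix_mul_assoc mat_mult_mat) (metis divide_eq_0_iff nonzero_divide_eq_eq)
qed

lemma carrier_PGL3: "carrier PGL3 = proj_class ` {A. invertible A}"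
  by (auto simp: PGL3_def FactGroup_def RCOSETS_def proj_class_def GL3_def)

lemma proj_class_mult:
  assumes "invertible A" "invertible B"
  shows "proj_class A \<otimes>\<^bsub>PGL3\<^esub> proj_class B = proj_class (A ** B)"
  using normal.rcos_sum[OF normal_scalars3, of A B] assms
  by (simp add: PGL3_def FactGroup_def proj_class_def GL3_def)

lemma one_PGL3: "\<one>\<^bsub>PGL3\<^esub> = proj_class (mat 1)"
  by (auto simp: PGL3_def FactGroup_def proj_class_eq scalars3_def)

lemma inv_proj_class:
  assumes "A ** B = mat 1"
  shows "inv\<^bsub>PGL3\<^esub> proj_class A = proj_class B"
proof -
  interpret group "PGL3 :: ('a^3^3) set monoid" by (rule group_PGL3)
  have "B ** A = mat 1"
    using assms matrix_left_right_inverse by blast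
  then have "invertible A" "invertible B"
    using assms by (auto simp: invertible_def)
  then show ?thesis
    using \<open>B ** A = mat 1\<close>
    by (intro inv_equality) (auto simp: proj_class_mult one_PGL3 carrier_PGL3)
qed

lemma proj_class_eq_one_iff: "invertible A \<Longrightarrow> proj_class A = \<one>\<^bsub>PGL3\<^esub> \<longleftrightarrow> is_scalar A"
proof -
  assume A: "invertible A"
  have "s \<noteq> 0" if "A = mat s" for s
    using A that by (auto simp: mat_eq_diag3 invertible_diag3_iff)
  then show ?thesis
    by (auto simp: one_PGL3 proj_class_eq_iff is_scalar_def)
qed

lemma aut_orders_le_3I:
  assumes "\<forall>\<sigma>\<in>Aut F. 1 \<le> group.ord PGL3 \<sigma> \<and> group.ord PGL3 \<sigma> \<le> 3"
  shows "aut_orders_le_3 F"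
  unfolding aut_orders_le_3_def
proof (intro allI impI)
  interpret group "PGL3 :: ('a^3^3) set monoid" by (rule group_PGL3)
  fix A assume A: "aut_matrix F A"
  then have inv: "invertible A" by (simp add: aut_matrix_def)
  then have c: "proj_class A \<in> carrier PGL3" by (simp add: carrier_PGL3)
  \<comment> \<open>The value 0 of \<open>ord\<close> stands for infinite order, so the lower bound
    carries information too.\<close>
  have "1 \<le> ord (proj_class A)" "ord (proj_class A) \<le> 3"
    using assms A by (auto simp: Aut_eq)
  then have "ord (proj_class A) \<in> {1, 2, 3}" by auto
  moreover have "proj_class A [^]\<^bsub>PGL3\<^esub> ord (proj_class A) = \<one>\<^bsub>PGL3\<^esub>"
    using c by (rule pow_ord_eq_1)
  moreover have "proj_class A [^]\<^bsub>PGL3\<^esub> (1::nat) = proj_class A"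
    "proj_class A [^]\<^bsub>PGL3\<^esub> (2::nat) = proj_class (A ** A)"
    "proj_class A [^]\<^bsub>PGL3\<^esub> (3::nat) = proj_class (A ** A ** A)"
    using c inv by (simp_all add: numeral_2_eq_2 numeral_3_eq_3 proj_class_mult invertible_mult)
  ultimately show "is_scalar A \<or> is_scalar (A ** A) \<or> is_scalar (A ** A ** A)"
    using inv by (auto simp: proj_class_eq_one_iff invertible_mult)
qed

lemma subgroup_Aut:
  assumes "homogeneous3 d F"
  shows "subgroup (Aut F) PGL3"
proof -
  interpret group "PGL3 :: ('a^3^3) set monoid" by (rule group_PGL3)
  show ?thesis
  proof (rule subgroupI)
    show "Aut F \<subseteq> carrier PGL3"
      by (auto simp: Aut_eq carrier_PGL3 aut_matrix_def)
    show "Aut F \<noteq> {}"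
      using aut_matrix_scalar[OF assms, of 1] by (auto simp: Aut_eq)
    fix \<sigma> assume "\<sigma> \<in> Aut F"
    then obtain A where A: "\<sigma> = proj_class A" "aut_matrix F A" by (auto simp: Aut_eq)
    then obtain B where "A ** B = mat 1" by (auto simp: aut_matrix_def invertible_def)
    then show "inv\<^bsub>PGL3\<^esub> \<sigma> \<in> Aut F"
      using A aut_matrix_inverse by (auto simp: Aut_eq inv_proj_class)
    fix \<tau> assume "\<tau> \<in> Aut F"
    then obtain C where C: "\<tau> = proj_class C" "aut_matrix F C" by (auto simp: Aut_eq)
    then show "\<sigma> \<otimes>\<^bsub>PGL3\<^esub> \<tau> \<in> Aut F"
      using A aut_matrix_mult[of F A C] by (simp add: Aut_eq proj_class_mult aut_matrix_def)
  qed
qed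

section \<open>Pairs of homologies\<close>

definition pairing :: "'a::field^3 \<Rightarrow> 'a^3 \<Rightarrow> 'a"
  where "pairing f x = (\<Sum>i\<in>UNIV. f $ i * x $ i)"

lemma pairing_add: "pairing f (x + y) = pairing f x + pairing f y"
  and pairing_smult: "pairing f (c *s x) = c * pairing f x"
  and pairing_0: "pairing f 0 = 0"
  by (simp_all add: pairing_def sum_3 algebra_simps)

lemma pairing_axis: "pairing f (axis i 1) = f $ i"
  using exhaust_3[of i] by (auto simp: pairing_def sum_3 axis_def)

text \<open>For \<open>pairing f p = 1\<close> this is the homology with centre \<open>p\<close>, axis \<open>f = 0\<close> and multiplier \<open>z\<close>.\<close>

definition homology_matrix :: "'a::field \<Rightarrow> 'a^3 \<Rightarrow> 'a^3 \<Rightarrow> 'a^3^3"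
  where "homology_matrix z p f = (\<chi> i j. (if i = j then 1 else 0) + (z - 1) * p $ i * f $ j)"

lemma homology_matrix_mult_vec: "homology_matrix z p f *v x = x + ((z - 1) * pairing f x) *s p"
  unfolding vec_eq_iff forall_3
  by (simp add: homology_matrix_def matrix_vector_mult_def pairing_def sum_3 algebra_simps)

text \<open>Conjugation moves the centre by A and the linear form of the axis by the inverse, so
  their pairing is kept.\<close>

lemma homology_matrix_conj:
  assumes "A ** B = mat 1"
  shows "A ** homology_matrix z p f ** B = homology_matrix z (A *v p) (f v* B)"
proof -
  have p: "pairing f (B *v x) = pairing (f v* B) x" for x
    by (simp add: pairing_def matrix_vector_mult_def vector_matrix_mult_def sum_3 algebra_simps)
  have "A *v (homology_matrix z p f *v (B *v x)) = A *v (B *v x) + A *v (((z - 1) * pairing f (B *v x)) *s p)" for x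
    by (simp add: homology_matrix_mult_vec matrix_vector_right_distrib)
  also have "\<dots> x = homology_matrix z (A *v p) (f v* B) *v x" for x
    by (simp add: matrix_vector_mul_assoc assms homology_matrix_mult_vec p vector_scalar_commute)
  finally show ?thesis
    by (simp add: matrix_eq matrix_vector_mul_assoc matrix_mul_assoc)
qed

lemma pairing_conj:
  assumes "A ** B = mat 1"
  shows "pairing (f v* B) (A *v p) = pairing f p"
proof -
  have "pairing f (B *v x) = pairing (f v* B) x" for x
    by (simp add: pairing_def matrix_vector_mult_def vector_matrix_mult_def sum_3 algebra_simps)
  moreover have "B ** A = mat 1"
    using assms matrix_left_right_inverse by blast
  ultimately show ?thesis
    by (metis matrix_vector_mul_assoc matrix_vector_mul_lid)
qed

text \<open>The two forms, padded with a zero row, make a singular matrix. Applied to two axes, this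
  yields a vector fixed by both homologies and all their products.\<close>

lemma common_kernel:
  obtains v where "v \<noteq> 0" "pairing f v = 0" "pairing g v = 0"
proof -
  define W :: "'a^3^3" where "W = (\<chi> i. if i = 1 then f else if i = 2 then g else 0)"
  have "row 3 W = 0" by (simp add: row_def W_def vec_eq_iff)
  then have "det W = 0" by (rule det_zero_row)
  then have "\<not> (\<exists>B. B ** W = mat 1)"
    by (metis invertible_det_nz invertible_left_inverse)
  then obtain v where v: "W *v v = 0" "v \<noteq> 0"
    by (auto simp: matrix_left_invertible_ker)
  have "pairing f v = (W *v v) $ 1" "pairing g v = (W *v v) $ 2"
    by (simp_all add: W_def pairing_def matrix_vector_mult_def)
  then show ?thesis using that v by simp
qed

lemma mat_mult_vec: "mat s *v x = s *s x"
  by (simp add: vec_eq_iff mat_def matrix_vector_mult_def if_distrib[where f = "\<lambda>x. x * _"] cong: if_cong)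

text \<open>A scalar power of M must be the identity because it fixes v. On the plane of p and q,
  with trace T and determinant D of M, Cayley-Hamilton gives \<open>M^2 = T M - D\<close> and
  \<open>M^3 = (T^2 - D) M - T D\<close>. Hence M is diagonal in the basis p, q, or the coefficient
  of M vanishes and the constant term is 1; these are the second and third alternatives.\<close>

lemma power_scalar_on_plane:
  fixes M :: "'a::field^3^3"
  assumes ind: "\<forall>c d. c *s p + d *s q = 0 \<longrightarrow> c = 0 \<and> d = 0"
    and Mp: "M *v p = \<alpha> *s p + \<beta> *s q" and Mq: "M *v q = \<gamma> *s p + \<delta> *s q"
    and v: "v \<noteq> 0" "M *v v = v"
    and M: "is_scalar M \<or> is_scalar (M ** M) \<or> is_scalar (M ** M ** M)"
  shows "\<beta> = 0 \<and> \<gamma> = 0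
    \<or> \<alpha> + \<delta> = 0 \<and> \<alpha> * \<delta> - \<beta> * \<gamma> = -1
    \<or> (\<alpha> + \<delta>)\<^sup>2 = \<alpha> * \<delta> - \<beta> * \<gamma> \<and> - (\<alpha> + \<delta>) * (\<alpha> * \<delta> - \<beta> * \<gamma>) = 1"
proof -
  have eq: "c = c' \<and> d = d'" if "c *s p + d *s q = c' *s p + d' *s q" for c d c' d'
    using ind[rule_format, of "c - c'" "d - d'"] that by (simp add: vector_sub_rdistrib algebra_simps)
  have one: "s = 1" if "N = mat s" "N *v v = v" for N s
  proof -
    have "s *s v = v" using that by (simp add: mat_mult_vec)
    then show ?thesis using v by (auto simp: vec_eq_iff)
  qed
  have lin: "M *v (c *s p + d *s q) = (c * \<alpha> + d * \<gamma>) *s p + (c * \<beta> + d * \<delta>) *s q" for c d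
    by (simp add: matrix_vector_right_distrib vector_scalar_commute Mp Mq vec_eq_iff algebra_simps)
  show ?thesis
    using M
  proof (elim disjE)
    assume "is_scalar M"
    then obtain s where s: "M = mat s" by (auto simp: is_scalar_def)
    then have "s *s p = \<alpha> *s p + \<beta> *s q" "s *s q = \<gamma> *s p + \<delta> *s q"
      using Mp Mq by (simp_all add: mat_mult_vec)
    then have "\<beta> = 0" "\<gamma> = 0"
      using eq[of s 0 \<alpha> \<beta>] eq[of 0 s \<gamma> \<delta>] by simp_all
    then show ?thesis by simp
  next
    assume "is_scalar (M ** M)"
    then obtain s where s: "M ** M = mat s" by (auto simp: is_scalar_def)
    moreover have "M ** M *v v = v"
      using v by (simp flip: matrix_vector_mul_assoc)
    ultimately have "s = 1" using one by blast
    then have "M *v (M *v x) = x" for x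
      using s by (simp add: matrix_vector_mul_assoc)
    from this[of p] this[of q]
    have "\<alpha> * \<alpha> + \<beta> * \<gamma> = 1 \<and> \<alpha> * \<beta> + \<beta> * \<delta> = 0" "\<gamma> * \<alpha> + \<delta> * \<gamma> = 0 \<and> \<gamma> * \<beta> + \<delta> * \<delta> = 1"
      using eq[of _ _ 1 0] eq[of _ _ 0 1] by (simp_all add: Mp Mq lin)
    then have "\<beta> * (\<alpha> + \<delta>) = 0" "\<gamma> * (\<alpha> + \<delta>) = 0" "\<alpha> * \<alpha> + \<beta> * \<gamma> = 1"
      by (simp_all add: algebra_simps)
    moreover have "\<alpha> * \<delta> - \<beta> * \<gamma> = -1" if "\<alpha> + \<delta> = 0"
    proof -
      have "\<delta> = - \<alpha>" using that by (simp add: eq_neg_iff_add_eq_0 add.commute)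
      moreover have "\<beta> * \<gamma> = 1 - \<alpha> * \<alpha>"
        using \<open>\<alpha> * \<alpha> + \<beta> * \<gamma> = 1\<close> by (simp add: eq_diff_eq add.commute)
      ultimately show ?thesis by simp
    qed
    ultimately show ?thesis by auto
  next
    assume "is_scalar (M ** M ** M)"
    then obtain s where s: "M ** M ** M = mat s" by (auto simp: is_scalar_def)
    moreover have "M ** M ** M *v v = v"
      using v by (simp flip: matrix_vector_mul_assoc)
    ultimately have "s = 1" using one by blast
    then have "M *v (M *v (M *v x)) = x" for x
      using s by (simp add: matrix_vector_mul_assoc matrix_mul_assoc)
    from this[of p] this[of q]
    have 1: "(\<alpha> * \<alpha> + \<beta> * \<gamma>) * \<alpha> + (\<alpha> * \<beta> + \<beta> * \<delta>) * \<gamma> = 1 \<and> (\<alpha> * \<alpha> + \<beta> * \<gamma>) * \<beta> + (\<alpha> * \<beta> + \<beta> * \<delta>) * \<delta> = 0"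
      "(\<gamma> * \<alpha> + \<delta> * \<gamma>) * \<alpha> + (\<gamma> * \<beta> + \<delta> * \<delta>) * \<gamma> = 0 \<and> (\<gamma> * \<alpha> + \<delta> * \<gamma>) * \<beta> + (\<gamma> * \<beta> + \<delta> * \<delta>) * \<delta> = 1"
      using eq[of _ _ 1 0] eq[of _ _ 0 1] by (simp_all add: Mp Mq lin)
    \<comment> \<open>The coefficient of M in the Cayley-Hamilton expression for its cube.\<close>
    let ?K = "(\<alpha> + \<delta>)\<^sup>2 - (\<alpha> * \<delta> - \<beta> * \<gamma>)"
    have 2: "?K * \<beta> = 0" "?K * \<gamma> = 0"
      "?K * \<alpha> - (\<alpha> + \<delta>) * (\<alpha> * \<delta> - \<beta> * \<gamma>) = 1"
      using 1 by (simp_all add: power2_eq_square algebra_simps)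
    show ?thesis
    proof (cases "?K = 0")
      case True
      have "- (\<alpha> + \<delta>) * (\<alpha> * \<delta> - \<beta> * \<gamma>) = 1"
        using 2(3) unfolding True by (simp only: mult_zero_left diff_0 mult_minus_left)
      moreover have "(\<alpha> + \<delta>)\<^sup>2 = \<alpha> * \<delta> - \<beta> * \<gamma>" using True by simp
      ultimately show ?thesis by blast
    next
      case False
      then show ?thesis using 2 by simp
    qed
  qed
qed

locale cube_root =
  fixes \<zeta> :: "'a::alg_closed_field"
  assumes prim: "primitive_root_of_unity 3 \<zeta>"
    and two_nz: "(2::'a) \<noteq> 0" and three_nz: "(3::'a) \<noteq> 0"
begin

lemma zeta_cube: "\<zeta> ^ 3 = 1" and zeta_neq_1: "\<zeta> \<noteq> 1" and zeta_sq_neq_1: "\<zeta>\<^sup>2 \<noteq> 1"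
  and zeta_neq_0: "\<zeta> \<noteq> 0"
proof -
  show "\<zeta> ^ 3 = 1" "\<zeta>\<^sup>2 \<noteq> 1"
    using prim by (auto simp: primitive_root_of_unity_def)
  then show "\<zeta> \<noteq> 1" "\<zeta> \<noteq> 0" by auto
qed

lemma zeta_sq: "\<zeta>\<^sup>2 = - \<zeta> - 1"
proof -
  have "(\<zeta> - 1) * (\<zeta>\<^sup>2 + \<zeta> + 1) = \<zeta> ^ 3 - 1"
    by (simp add: power2_eq_square power3_eq_cube algebra_simps)
  then have "\<zeta>\<^sup>2 + \<zeta> + 1 = 0"
    using zeta_cube zeta_neq_1 by simp
  then show ?thesis by (simp add: eq_neg_iff_add_eq_0 algebra_simps)
qed

lemma zeta_zeta: "\<zeta> * \<zeta> = - \<zeta> - 1"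
  using zeta_sq by (simp add: power2_eq_square)

text \<open>Companion of \<open>zeta_zeta\<close> for right-nested products. Together they reduce
  every polynomial in \<zeta> to degree at most 1.\<close>

lemma zeta_zeta_left: "\<zeta> * (\<zeta> * x) = - (\<zeta> * x) - x"
  by (simp add: mult.assoc[symmetric] zeta_zeta algebra_simps)

lemma homology_square:
  assumes "pairing f p = 1"
  shows "homology_matrix \<zeta> p f ** homology_matrix \<zeta> p f = homology_matrix (\<zeta>\<^sup>2) p f"
proof -
  have "homology_matrix \<zeta> p f *v (homology_matrix \<zeta> p f *v x) = homology_matrix (\<zeta>\<^sup>2) p f *v x" for x
    by (simp add: homology_matrix_mult_vec pairing_add pairing_smult assms)
      (simp add: vec_eq_iff power2_eq_square algebra_simps)
  then show ?thesis by (simp add: matrix_eq matrix_vector_mul_assoc)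
qed

text \<open>Let \<open>M = r s\<close> and \<open>N = r s\<^sup>2\<close>, and put \<open>t = f(q) g(p)\<close>. If \<open>p\<close> and \<open>q\<close> are independent, the order
  of \<open>M\<close>, which has determinant \<open>\<zeta>\<^sup>2\<close> on their span, forces \<open>f(q) = g(p) = 0\<close> or \<open>t = 1\<close>, and in the
  latter case \<open>N\<close> is unipotent there and not the identity. If they are dependent, \<open>N\<close> is a transvection.\<close>

lemma homologies_equal_or_orthogonal:
  assumes F: "aut_orders_le_3 F"
    and r: "aut_matrix F (homology_matrix \<zeta> p f)" "pairing f p = 1"
    and r': "aut_matrix F (homology_matrix \<zeta> q g)" "pairing g q = 1"
  shows "homology_matrix \<zeta> p f = homology_matrix \<zeta> q g \<or> pairing f q = 0 \<and> pairing g p = 0"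
proof -
  let ?r = "homology_matrix \<zeta> p f" and ?s = "homology_matrix \<zeta> q g"
  define M where "M = ?r ** ?s"
  \<comment> \<open>Since \<zeta>^3 = 1, the homology with multiplier \<open>\<zeta>\<^sup>2\<close>
    is both the square and the inverse of the second one.\<close>
  define N where "N = ?r ** homology_matrix (\<zeta>\<^sup>2) q g"
  have M: "is_scalar M \<or> is_scalar (M ** M) \<or> is_scalar (M ** M ** M)"
    using F aut_matrix_mult[OF r(1) r'(1)] by (auto simp: M_def aut_orders_le_3_def)
  have N: "is_scalar N \<or> is_scalar (N ** N) \<or> is_scalar (N ** N ** N)"
    using F aut_matrix_mult[OF r(1) aut_matrix_mult[OF r'(1) r'(1)]]
    by (auto simp: N_def aut_orders_le_3_def homology_square[OF r'(2)])
  have Mv: "M *v x = ?r *v (?s *v x)" and Nv: "N *v x = ?r *v (homology_matrix (\<zeta>\<^sup>2) q g *v x)" for x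
    by (simp_all add: M_def N_def matrix_vector_mul_assoc)
  have "p \<noteq> 0" "q \<noteq> 0" using r r' by (auto simp: pairing_0)
  show ?thesis
  proof (cases "\<exists>c. q = c *s p")
    case True
    then obtain c where c: "q = c *s p" by blast
    \<comment> \<open>N acts as x \<mapsto> x + (\<zeta> - 1) h(x) p with h(p) = 0, so its k-th
      power multiplies h by k. As 2 and 3 are nonzero, a scalar power forces h = 0, that is,
      equality of the two rank one parts.\<close>
    define h where "h x = pairing f x - c * pairing g x" for x
    have hp: "h p = 0"
      using r r' by (simp add: h_def c pairing_smult)
    have h_add: "h (x + d *s y) = h x + d * h y" for x y d
      by (simp add: h_def pairing_add pairing_smult algebra_simps)
    have Nx: "N *v x = x + ((\<zeta> - 1) * h x) *s p" for x
      using r by (simp add: Nv homology_matrix_mult_vec h_def c pairing_add pairing_smult)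
        (simp add: vec_eq_iff power2_eq_square algebra_simps zeta_zeta zeta_zeta_left)
    have step: "N *v (x + c *s p) = x + (c + (\<zeta> - 1) * h x) *s p" for x c
      by (simp add: Nx h_add hp) (simp add: vec_eq_iff algebra_simps)
    have "h x = 0" for x
      using N
    proof (elim disjE)
      assume "is_scalar N"
      then obtain s where s: "N = mat s" by (auto simp: is_scalar_def)
      have "s *s p = p" using Nx[of p] s by (simp add: hp mat_mult_vec)
      then have "s = 1" using \<open>p \<noteq> 0\<close> by (auto simp: vec_eq_iff)
      then show ?thesis using Nx[of x] s \<open>p \<noteq> 0\<close> zeta_neq_1 by simp
    next
      assume "is_scalar (N ** N)"
      then obtain s where s: "N ** N = mat s" by (auto simp: is_scalar_def)
      have 2: "N *v (N *v x) = x + (2 * (\<zeta> - 1) * h x) *s p" for x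
        by (simp only: Nx[of x] step) (simp add: algebra_simps)
      have "s *s p = p" using 2[of p] s by (simp add: hp mat_mult_vec matrix_vector_mul_assoc)
      then have "s = 1" using \<open>p \<noteq> 0\<close> by (auto simp: vec_eq_iff)
      then show ?thesis
        using 2[of x] s \<open>p \<noteq> 0\<close> zeta_neq_1 two_nz by (simp add: matrix_vector_mul_assoc)
    next
      assume "is_scalar (N ** N ** N)"
      then obtain s where s: "N ** N ** N = mat s" by (auto simp: is_scalar_def)
      have 3: "N *v (N *v (N *v x)) = x + (3 * (\<zeta> - 1) * h x) *s p" for x
        by (simp only: Nx[of x] step) (simp add: algebra_simps)
      have "s *s p = p" using 3[of p] s by (simp add: hp mat_mult_vec matrix_vector_mul_assoc matrix_mul_assoc)
      then have "s = 1" using \<open>p \<noteq> 0\<close> by (auto simp: vec_eq_iff)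
      then show ?thesis
        using 3[of x] s \<open>p \<noteq> 0\<close> zeta_neq_1 three_nz by (simp add: matrix_vector_mul_assoc matrix_mul_assoc)
    qed
    from this[of "axis _ 1"] have "f $ i = c * g $ i" for i
      by (simp add: h_def pairing_axis)
    then show ?thesis by (simp add: homology_matrix_def c vec_eq_iff)
  next
    case False
    have ind: "\<forall>c d. c *s p + d *s q = 0 \<longrightarrow> c = 0 \<and> d = 0"
    proof (intro allI impI)
      fix c d assume that: "c *s p + d *s q = 0"
      have "d = 0"
      proof (rule ccontr)
        assume "d \<noteq> 0"
        have "q = (- c / d) *s p"
        proof (rule vec_eq_iff[THEN iffD2], rule allI)
          fix i
          have "c * p $ i + d * q $ i = 0"
            using arg_cong[OF that, of "\<lambda>v. v $ i"] by simp
          then show "q $ i = ((- c / d) *s p) $ i"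
            using \<open>d \<noteq> 0\<close> by (simp add: field_simps eq_neg_iff_add_eq_0)
        qed
        then show False using False by blast
      qed
      then show "c = 0 \<and> d = 0" using that \<open>p \<noteq> 0\<close> by simp
    qed
    obtain v where v: "v \<noteq> 0" "pairing f v = 0" "pairing g v = 0"
      by (rule common_kernel)
    define x where "x = pairing f q"
    define y where "y = pairing g p"
    have Mp: "M *v p = (\<zeta> + (\<zeta> - 1)\<^sup>2 * x * y) *s p + ((\<zeta> - 1) * y) *s q"
      and Mq: "M *v q = (\<zeta> * (\<zeta> - 1) * x) *s p + \<zeta> *s q" and Mvv: "M *v v = v"
      using r r' v by (simp_all add: Mv homology_matrix_mult_vec pairing_add pairing_smult flip: x_def y_def)
        (simp_all add: vec_eq_iff power2_eq_square algebra_simps)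
    \<comment> \<open>The coefficient 3 is (\<zeta> - 1)(\<zeta>^2 - 1). Similarly the -3\<zeta> in
      \<open>trM\<close> is (\<zeta> - 1)^2.\<close>
    have Np: "N *v p = (\<zeta> + 3 * x * y) *s p + ((\<zeta>\<^sup>2 - 1) * y) *s q"
      and Nq: "N *v q = (\<zeta>\<^sup>2 * (\<zeta> - 1) * x) *s p + \<zeta>\<^sup>2 *s q" and Nvv: "N *v v = v"
      using r r' v by (simp_all add: Nv homology_matrix_mult_vec pairing_add pairing_smult flip: x_def y_def)
        (simp_all add: vec_eq_iff power2_eq_square algebra_simps zeta_zeta zeta_zeta_left)
    have a0: "\<zeta> - 1 \<noteq> 0" "\<zeta>\<^sup>2 - 1 \<noteq> 0" using zeta_neq_1 zeta_sq_neq_1 by auto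
    have detM: "(\<zeta> + (\<zeta> - 1)\<^sup>2 * x * y) * \<zeta> - ((\<zeta> - 1) * y) * (\<zeta> * (\<zeta> - 1) * x) = \<zeta>\<^sup>2"
      by (simp add: power2_eq_square algebra_simps)
    have detN: "(\<zeta> + 3 * x * y) * \<zeta>\<^sup>2 - ((\<zeta>\<^sup>2 - 1) * y) * (\<zeta>\<^sup>2 * (\<zeta> - 1) * x) = 1"
      by (simp add: power2_eq_square algebra_simps zeta_zeta zeta_zeta_left)
    have trM: "\<zeta> + (\<zeta> - 1)\<^sup>2 * x * y + \<zeta> = 2 * \<zeta> - 3 * \<zeta> * (x * y)"
      by (simp add: power2_eq_square algebra_simps zeta_zeta zeta_zeta_left)
    have trN: "\<zeta> + 3 * x * y + \<zeta>\<^sup>2 = 3 * (x * y) - 1"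
      by (simp add: zeta_sq)
    \<comment> \<open>Trace zero would need \<zeta>^2 = -1, which contradicts \<zeta>^2 = -\<zeta> -
      1. The order 3 alternative reads 3xy - 2 = 1.\<close>
    have "x = 0 \<and> y = 0 \<or> x * y = 1"
      using power_scalar_on_plane[OF ind Mp Mq v(1) Mvv M, unfolded detM trM]
    proof (elim disjE conjE)
      assume "(\<zeta> - 1) * y = 0" "\<zeta> * (\<zeta> - 1) * x = 0"
      then show ?thesis using a0 zeta_neq_0 by simp
    next
      assume "\<zeta>\<^sup>2 = - 1"
      then have "\<zeta> = 0" using zeta_sq by simp
      then show ?thesis using zeta_neq_0 by simp
    next
      assume "- (2 * \<zeta> - 3 * \<zeta> * (x * y)) * \<zeta>\<^sup>2 = 1"
      moreover have "- (2 * \<zeta> - 3 * \<zeta> * (x * y)) * \<zeta>\<^sup>2 = \<zeta> ^ 3 * (3 * (x * y) - 2)"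
        by (simp add: power2_eq_square power3_eq_cube algebra_simps)
      ultimately have "3 * (x * y) - 2 = 1" using zeta_cube by simp
      then have "3 * (x * y) = 3 * 1" by (simp add: algebra_simps)
      then show ?thesis using three_nz mult_left_cancel by blast
    qed
    \<comment> \<open>Now N has trace 2 and determinant 1 on the plane, and it is not diagonal
      because y is nonzero. The remaining alternatives would require 2 = 0 or 4 = 1.\<close>
    moreover have False if "x * y = 1"
    proof -
      have tr: "3 * (x * y) - 1 = 2" using that by simp
      have "y \<noteq> 0" using that by auto
      have "(2::'a)\<^sup>2 = 1 + 3" by simp
      then have f1: "(2::'a)\<^sup>2 = 1 \<longleftrightarrow> (3::'a) = 0"
        by (simp only: add_cancel_left_right)
      show False
        using power_scalar_on_plane[OF ind Np Nq v(1) Nvv N, unfolded detN trN tr]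
          \<open>y \<noteq> 0\<close> a0 two_nz three_nz f1 by auto
    qed
    ultimately show ?thesis by (auto simp: x_def y_def)
  qed
qed

end

section \<open>Smooth sextics with a homology\<close>

text \<open>At the i-th coordinate point F and its first derivatives only see monomials whose
  exponent of the i-th variable is at least d - 1. Without any of these the point would be
  singular.\<close>

lemma smooth_plane_curve_corner:
  assumes "smooth_plane_curve d F"
  obtains m where "m \<in> Poly_Mapping.keys F" "d \<le> Suc (Poly_Mapping.lookup m i)"
proof (rule ccontr)
  assume "\<not> thesis"
  then have small: "Suc (Poly_Mapping.lookup m i) < d" if "m \<in> Poly_Mapping.keys F" for m
    using that \<open>\<And>m. m \<in> _ \<Longrightarrow> _ \<Longrightarrow> thesis\<close> by force
  have deg: "(\<Sum>j\<in>UNIV. Poly_Mapping.lookup m j) = d" if "m \<in> Poly_Mapping.keys F" for m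
    using assms that by (auto simp: smooth_plane_curve_def homogeneous3_def)
  let ?v = "axis i 1 :: 'a^3"
  \<comment> \<open>Here n is m itself or m with its k-th exponent lowered by one. As the i-th
    exponent of m is at most d - 2, some other variable survives in n and vanishes at the
    point.\<close>
  have zero: "(\<Prod>j\<in>UNIV. ?v $ j ^ Poly_Mapping.lookup n j) = 0"
    if "m \<in> Poly_Mapping.keys F" "\<And>j. Poly_Mapping.lookup m j \<le> Poly_Mapping.lookup n j + (if j = k then 1 else 0)"
      "Poly_Mapping.lookup n i \<le> Poly_Mapping.lookup m i" for m n k
  proof -
    have "\<exists>j. j \<noteq> i \<and> Poly_Mapping.lookup n j \<noteq> 0"
    proof (rule ccontr)
      assume "\<not> ?thesis"
      then have n: "Poly_Mapping.lookup n j = 0" if "j \<noteq> i" for j using that by blast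
      have "d \<le> (\<Sum>j\<in>UNIV. Poly_Mapping.lookup n j + (if j = k then 1 else 0))"
        unfolding deg[OF that(1), symmetric] by (rule sum_mono) (rule that(2))
      also have "\<dots> = (\<Sum>j\<in>UNIV. if j = i then Poly_Mapping.lookup n i else 0) + 1"
        unfolding sum.distrib by (intro arg_cong2[of _ _ _ _ "(+)"] sum.cong) (auto simp: n)
      also have "\<dots> = Poly_Mapping.lookup n i + 1" by simp
      finally show False using small[OF that(1)] that(3) by simp
    qed
    then show ?thesis by (auto simp: axis_def power_0_left intro!: prod_zero)
  qed
  have "eval3 F ?v = 0"
    unfolding eval3_def using zero[of _ _ i] by (intro sum.neutral) auto
  moreover have "eval3 (pderiv3 k F) ?v = 0" for k
    unfolding pderiv3_def eval3_sum eval3_single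
  proof (intro sum.neutral ballI)
    fix m assume "m \<in> Poly_Mapping.keys F"
    then have "(\<Prod>j\<in>UNIV. ?v $ j ^ Poly_Mapping.lookup (m - Poly_Mapping.single k 1) j) = 0"
      by (rule zero[where k = k]) (auto simp: lookup_minus lookup_single when_def)
    then show "of_nat (Poly_Mapping.lookup m k) * Poly_Mapping.lookup F m
        * (\<Prod>j\<in>UNIV. ?v $ j ^ Poly_Mapping.lookup (m - Poly_Mapping.single k 1) j) = 0"
      by (simp only: mult_zero_right)
  qed
  moreover have "?v \<noteq> 0"
    by (auto simp: axis_def vec_eq_iff)
  ultimately show False
    using assms by (auto simp: smooth_plane_curve_def)
qed

text \<open>The converse of \<open>aut_matrix_conj\<close>, obtained by applying it to the inverse
  change of variables.\<close>

lemma aut_matrix_lin_subst: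
  assumes "aut_matrix F (P ** B ** Q)" "P ** Q = mat 1" "c \<noteq> 0"
  shows "aut_matrix (Const c * lin_subst P F) B"
proof -
  let ?G = "Const c * lin_subst P F"
  have QP: "Q ** P = mat 1"
    using assms matrix_left_right_inverse by blast
  have "Const (inverse c) * lin_subst Q ?G = Const (inverse c) * (Const c * F)"
    using assms by (simp add: lin_subst_simps lin_subst_lin_subst)
  also have "\<dots> = Const (inverse c * c) * F"
    by (simp only: Const_mult mult.assoc)
  finally have "Const (inverse c) * lin_subst Q ?G = Const (inverse c * c) * F" .
  then have "F = Const (inverse c) * lin_subst Q ?G"
    using assms by simp
  then have "aut_matrix (Const (inverse c) * lin_subst Q ?G) (P ** B ** Q)"
    using assms(1) by simp
  then have "aut_matrix ?G (Q ** (P ** B ** Q) ** P)"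
    by (rule aut_matrix_conj) (use assms QP in simp_all)
  moreover have "Q ** (P ** B ** Q) ** P = B"
    by (simp add: matrix_mul_assoc QP) (simp add: QP flip: matrix_mul_assoc)
  ultimately show ?thesis by simp
qed

lemma invertible_if_square: "invertible (A ** A) \<Longrightarrow> invertible A" for A :: "'a::field^3^3"
  by (simp add: invertible_det_nz det_mul)

section \<open>Coordinate homologies and monomial matrices\<close>

definition coord_homology :: "'a::field \<Rightarrow> 3 \<Rightarrow> 'a^3^3"
  where "coord_homology z k = diag3 (\<lambda>i. if i = k then z else 1)"

lemma coord_homology_eq: "coord_homology z k = homology_matrix z (axis k 1) (axis k 1)"
  by (auto simp: coord_homology_def homology_matrix_def vec_eq_iff axis_def)

lemma pdiag_eq: "pdiag a b = proj_class (diag3 (\<lambda>i. if i = 1 then 1 else if i = 2 then a else b))"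
  by (simp add: pdiag_def diag3_def if_distrib vec_eq_iff) (rule arg_cong[of _ _ proj_class], simp add: vec_eq_iff)

lemma pdiag_coord_homology: "pdiag 1 z = proj_class (coord_homology z 3)" "pdiag z 1 = proj_class (coord_homology z 2)"
proof -
  have "diag3 (\<lambda>i. if i = 1 then 1 else if i = 2 then 1 else z) = coord_homology z 3"
    "diag3 (\<lambda>i. if i = 1 then 1 else if i = 2 then z else 1) = coord_homology z 2"
    using exhaust_3 by (auto simp: coord_homology_def diag3_eq_iff)
  then show "pdiag 1 z = proj_class (coord_homology z 3)" "pdiag z 1 = proj_class (coord_homology z 2)"
    by (simp_all only: pdiag_eq)
qed

text \<open>The entry at (a, b) prevents A from being scalar, two different values of e prevent
  \<open>A ** A\<close>, and in the cube the entry at (a, b) is only multiplied by the nonzero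
  \<open>e a\<close>.\<close>

lemma not_orders_le_3:
  assumes "aut_matrix F A" "A ** A = diag3 e" "A $ a $ b \<noteq> 0" "a \<noteq> b" "e a \<noteq> 0" "e c \<noteq> e a"
  shows "\<not> aut_orders_le_3 F"
proof
  assume "aut_orders_le_3 F"
  then consider "is_scalar A" | "is_scalar (diag3 e)" | "is_scalar (diag3 e ** A)"
    using assms by (auto simp: aut_orders_le_3_def)
  then show False
  proof cases
    case 1
    then show False using assms by (auto simp: is_scalar_def mat_def)
  next
    case 2
    then show False using assms by (auto simp: is_scalar_def mat_eq_diag3 diag3_eq_iff)
  next
    case 3
    then have "(diag3 e ** A) $ a $ b = 0" using assms by (auto simp: is_scalar_def mat_def)
    moreover have "(diag3 e ** A) $ a $ b = e a * A $ a $ b"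
      by (simp add: matrix_matrix_mult_def if_distrib[where f = "\<lambda>x. x * _"] cong: if_cong)
    ultimately show False using assms by simp
  qed
qed

definition monomial_matrix :: "(3 \<Rightarrow> 3) \<Rightarrow> (3 \<Rightarrow> 'a::field) \<Rightarrow> 'a^3^3"
  where "monomial_matrix \<tau> d = (\<chi> i j. if j = \<tau> i then d i else 0)"

lemma monomial_matrix_mult:
  "monomial_matrix \<tau> d ** monomial_matrix \<upsilon> e = monomial_matrix (\<lambda>i. \<upsilon> (\<tau> i)) (\<lambda>i. d i * e (\<tau> i))"
  by (simp add: monomial_matrix_def vec_eq_iff matrix_matrix_mult_def if_distrib[where f = "\<lambda>x. x * _"]
     cong: if_cong)

lemma lin_subst_monomial_matrix:
  "lin_subst (monomial_matrix \<tau> d) (Var i) = Const (d i) * Var (\<tau> i)"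
  using exhaust_3[of "\<tau> i"] by (auto simp: lin_subst_Var monomial_matrix_def sum_3)

lemma monomial_matrix_id: "monomial_matrix (\<lambda>i. i) d = diag3 d"
  by (auto simp: monomial_matrix_def vec_eq_iff)

context cube_root
begin

lemma zeta_power_eq_1_iff: "\<zeta> ^ n = 1 \<longleftrightarrow> 3 dvd n"
proof -
  have "\<zeta> ^ n = (\<zeta> ^ 3) ^ (n div 3) * \<zeta> ^ (n mod 3)"
    by (simp flip: power_mult power_add)
  then have *: "\<zeta> ^ n = \<zeta> ^ (n mod 3)" by (simp add: zeta_cube)
  consider "n mod 3 = 0" | "n mod 3 = 1" | "n mod 3 = 2" by linarith
  then show ?thesis
    using zeta_neq_1 zeta_sq_neq_1 by cases (simp_all add: * dvd_eq_mod_eq_0)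
qed

lemma cube_eq_cases:
  assumes "x ^ 3 = y ^ 3"
  shows "x = y \<or> x = \<zeta> * y \<or> x = \<zeta>\<^sup>2 * y"
proof -
  have "(x - y) * ((x - \<zeta> * y) * (x - \<zeta>\<^sup>2 * y)) = x ^ 3 - y ^ 3"
    by (simp add: power2_eq_square power3_eq_cube algebra_simps zeta_zeta zeta_zeta_left)
  then show ?thesis using assms by simp
qed

text \<open>All monomials share one eigenvalue \<open>\<zeta> ^ e\<close>, where e is the exponent
  of the k-th variable. Smoothness at the k-th coordinate point provides e = 5 or 6, at another
  coordinate point e = 0 or 1. Modulo 3 only 6 and 0 agree, so the eigenvalue is 1 and the pure
  sixth power occurs.\<close>

lemma coord_homology_keys:
  assumes F: "smooth_plane_curve 6 F" "aut_matrix F (coord_homology \<zeta> k)"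
  shows "\<And>m. m \<in> Poly_Mapping.keys F \<Longrightarrow> 3 dvd Poly_Mapping.lookup m k"
    and "Poly_Mapping.lookup F (Poly_Mapping.single k 6) \<noteq> 0"
proof -
  obtain c where c: "lin_subst (coord_homology \<zeta> k) F = Const c * F"
    using F by (auto simp: aut_matrix_def)
  have pow: "\<zeta> ^ Poly_Mapping.lookup m k = c" if "m \<in> Poly_Mapping.keys F" for m
  proof -
    have "(\<Prod>i\<in>UNIV. (if i = k then \<zeta> else 1) ^ Poly_Mapping.lookup m i)
        = (\<Prod>i\<in>UNIV. if i = k then \<zeta> ^ Poly_Mapping.lookup m k else 1)"
      by (intro prod.cong) auto
    then show ?thesis
      using arg_cong[OF c, of "\<lambda>G. Poly_Mapping.lookup G m"] that
      by (simp add: coord_homology_def lookup_lin_subst_diag3 lookup_Const_mult in_keys_iff)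
  qed
  have deg: "(\<Sum>j\<in>UNIV. Poly_Mapping.lookup m j) = 6" if "m \<in> Poly_Mapping.keys F" for m
    using F that by (auto simp: smooth_plane_curve_def homogeneous3_def)
  have sum2: "Poly_Mapping.lookup m i + Poly_Mapping.lookup m j \<le> 6"
    if "m \<in> Poly_Mapping.keys F" "i \<noteq> j" for m i j
    using deg[OF that(1)] that(2) exhaust_3[of i] exhaust_3[of j] by (auto simp: sum_3)
  obtain m where m: "m \<in> Poly_Mapping.keys F" "6 \<le> Suc (Poly_Mapping.lookup m k)"
    using smooth_plane_curve_corner[OF F(1)] .
  obtain j where j: "j \<noteq> k" using that[of 1] that[of 2] by (cases "k = 1") auto
  obtain n where n: "n \<in> Poly_Mapping.keys F" "6 \<le> Suc (Poly_Mapping.lookup n j)"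
    using smooth_plane_curve_corner[OF F(1)] .
  have "Poly_Mapping.lookup n k = 0 \<or> Poly_Mapping.lookup n k = 1"
    using sum2[OF n(1) j] n(2) by linarith
  moreover have "Poly_Mapping.lookup m k = 5 \<or> Poly_Mapping.lookup m k = 6"
    using sum2[OF m(1) j] m(2) by linarith
  moreover have "\<zeta> ^ Poly_Mapping.lookup m k = \<zeta> ^ Poly_Mapping.lookup n k"
    using pow m n by simp
  moreover have "\<zeta> ^ 5 \<noteq> 1" "\<zeta> ^ 6 = 1"
    using zeta_power_eq_1_iff[of 5] zeta_power_eq_1_iff[of 6] by simp_all
  moreover have "\<zeta> ^ 5 \<noteq> \<zeta>"
  proof
    assume "\<zeta> ^ 5 = \<zeta>"
    then have "\<zeta> * \<zeta> ^ 4 = \<zeta> * 1" by (simp flip: power_Suc)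
    then have "\<zeta> ^ 4 = 1" using zeta_neq_0 by (simp only: mult_cancel_left) simp
    then show False using zeta_power_eq_1_iff[of 4] by simp
  qed
  ultimately have 6: "Poly_Mapping.lookup m k = 6" and n0: "Poly_Mapping.lookup n k = 0"
    using zeta_neq_1 by auto
  have "c = 1" using pow[OF n(1)] n0 by simp
  then show "3 dvd Poly_Mapping.lookup m k" if "m \<in> Poly_Mapping.keys F" for m
    using pow[OF that] zeta_power_eq_1_iff by simp
  have "m = Poly_Mapping.single k 6"
  proof (rule poly_mapping_eqI)
    fix i
    show "Poly_Mapping.lookup m i = Poly_Mapping.lookup (Poly_Mapping.single k 6) i"
      using sum2[OF m(1), of i k] 6 by (auto simp: lookup_single when_def)
  qed
  then show "Poly_Mapping.lookup F (Poly_Mapping.single k 6) \<noteq> 0"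
    using m by (simp add: in_keys_iff)
qed

text \<open>An automorphism of order 2 that commutes with the homology would have a product of order 6 with it.\<close>

lemma commuting_cube_scalar:
  assumes F: "aut_orders_le_3 F" and A: "aut_matrix F A"
    and D: "aut_matrix F (coord_homology \<zeta> k)"
    and comm: "A ** coord_homology \<zeta> k = coord_homology \<zeta> k ** A"
  shows "is_scalar (A ** A ** A)"
proof -
  let ?D = "coord_homology \<zeta> k"
  obtain j :: 3 where j: "j \<noteq> k" using that[of 1] that[of 2] by (cases "k = 1") auto
  have D3: "?D ** ?D ** ?D = mat 1"
    using zeta_cube by (auto simp: coord_homology_def diag3_mult mat_eq_diag3 diag3_eq_iff power3_eq_cube)
  consider "is_scalar A" | "is_scalar (A ** A)" | "is_scalar (A ** A ** A)"
    using F A by (auto simp: aut_orders_le_3_def)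
  then show ?thesis
  proof cases
    case 1
    then show ?thesis by (auto simp: is_scalar_def mat_mult_mat)
  next
    case 2
    then obtain s where s: "A ** A = mat s" by (auto simp: is_scalar_def)
    have "invertible (A ** A)" using A by (simp add: aut_matrix_def invertible_mult)
    then have "s \<noteq> 0" by (simp add: s mat_eq_diag3 invertible_diag3_iff)
    let ?B = "?D ** A"
    have comm': "X ** A ** ?D = X ** ?D ** A" for X
      using comm by (simp flip: matrix_mul_assoc)
    have B2: "?B ** ?B = ?D ** ?D ** (A ** A)"
      and B3: "?B ** ?B ** ?B = ?D ** ?D ** ?D ** (A ** A ** A)"
      by (simp_all add: matrix_mul_assoc comm')
    have "aut_matrix F ?B" using aut_matrix_mult D A by blast
    then consider "is_scalar ?B" | "is_scalar (?B ** ?B)" | "is_scalar (?B ** ?B ** ?B)"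
      using F by (auto simp: aut_orders_le_3_def)
    then show ?thesis
    proof cases
      case 1
      then obtain t where t: "?B = mat t" by (auto simp: is_scalar_def)
      have "A ** A ** A = ?D ** ?D ** ?D ** (A ** A ** A)" by (simp add: D3)
      also have "\<dots> = mat t ** mat t ** mat t" using B3 t by simp
      finally show ?thesis by (auto simp: is_scalar_def mat_mult_mat)
    next
      case 2
      then have "is_scalar (diag3 (\<lambda>i. (if i = k then \<zeta>\<^sup>2 else 1) * s))"
        unfolding B2 s by (simp add: coord_homology_def diag3_mult mat_eq_diag3 power2_eq_square
           if_distrib[where f = "\<lambda>x. x * _"] cong: if_cong)
      then have "(if k = k then \<zeta>\<^sup>2 else 1) * s = (if j = k then \<zeta>\<^sup>2 else 1) * s"
        by (auto simp only: is_scalar_def mat_eq_diag3 diag3_eq_iff)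
      then show ?thesis using j \<open>s \<noteq> 0\<close> zeta_sq_neq_1 by simp
    next
      case 3
      then show ?thesis unfolding B3 D3 by simp
    qed
  qed
qed

end

section \<open>The special sextics\<close>

definition mon3 :: "nat \<Rightarrow> nat \<Rightarrow> nat \<Rightarrow> 3 \<Rightarrow>\<^sub>0 nat"
  where "mon3 i j k = Poly_Mapping.single 1 i + Poly_Mapping.single 2 j + Poly_Mapping.single 3 k"

lemma lookup_mon3 [simp]:
  "Poly_Mapping.lookup (mon3 i j k) 1 = i" "Poly_Mapping.lookup (mon3 i j k) 2 = j"
  "Poly_Mapping.lookup (mon3 i j k) 3 = k"
  by (simp_all add: mon3_def lookup_add lookup_single)

lemma mon3_lookup: "mon3 (Poly_Mapping.lookup m 1) (Poly_Mapping.lookup m 2) (Poly_Mapping.lookup m 3) = m"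
proof (rule poly_mapping_eqI)
  fix i
  show "Poly_Mapping.lookup (mon3 (Poly_Mapping.lookup m 1) (Poly_Mapping.lookup m 2) (Poly_Mapping.lookup m 3)) i
      = Poly_Mapping.lookup m i"
    using exhaust_3[of i] by (elim disjE) (simp_all only: lookup_mon3)
qed

lemma mon3_eq_iff [simp]: "mon3 i j k = mon3 i' j' k' \<longleftrightarrow> i = i' \<and> j = j' \<and> k = k'"
  by (metis lookup_mon3)

lemma single_mon3: "Poly_Mapping.single (mon3 i j k) a = Const a * varX ^ i * varY ^ j * varZ ^ k"
  by (simp add: single_eq_Const_mult prod_3 mult.assoc)

lemma mon3_single: "Poly_Mapping.single 1 n = mon3 n 0 0" "Poly_Mapping.single 2 n = mon3 0 n 0"
  "Poly_Mapping.single 3 n = mon3 0 0 n"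
  by (simp_all add: mon3_def)

text \<open>After division by 3 the exponent vectors are those of degree 2 in three variables. The
  squares have coefficient 1, and the three mixed terms are the parameters.\<close>

lemma special_sextic_eqI:
  assumes H: "homogeneous3 6 H"
    and dvd: "\<And>m i. m \<in> Poly_Mapping.keys H \<Longrightarrow> 3 dvd Poly_Mapping.lookup m i"
    and one: "\<And>i. Poly_Mapping.lookup H (Poly_Mapping.single i 6) = 1"
  shows "H = special_sextic (Poly_Mapping.lookup H (mon3 3 0 3)) (Poly_Mapping.lookup H (mon3 0 3 3))
      (Poly_Mapping.lookup H (mon3 3 3 0))"
proof -
  let ?S = "{mon3 6 0 0, mon3 0 6 0, mon3 0 0 6, mon3 3 0 3, mon3 0 3 3, mon3 3 3 0}"
  have "Poly_Mapping.keys H \<subseteq> ?S"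
  proof
    fix m assume m: "m \<in> Poly_Mapping.keys H"
    obtain a where a: "Poly_Mapping.lookup m 1 = 3 * a" by (rule dvdE[OF dvd[OF m, of 1]])
    obtain b where b: "Poly_Mapping.lookup m 2 = 3 * b" by (rule dvdE[OF dvd[OF m, of 2]])
    obtain c where c: "Poly_Mapping.lookup m 3 = 3 * c" by (rule dvdE[OF dvd[OF m, of 3]])
    have "Poly_Mapping.lookup m 1 + Poly_Mapping.lookup m 2 + Poly_Mapping.lookup m 3 = 6"
      using H m by (auto simp: homogeneous3_def sum_3)
    then have abc: "a + b + c = 2" using a b c by linarith
    then have c': "c = 2 - a - b" by simp
    have "a = 0 \<or> a = 1 \<or> a = 2" "b = 0 \<or> b = 1 \<or> b = 2" using abc by linarith+
    then have "mon3 (3 * a) (3 * b) (3 * c) \<in> ?S"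
      using abc unfolding c' by (elim disjE) simp_all
    moreover have "m = mon3 (3 * a) (3 * b) (3 * c)"
      using mon3_lookup[of m] by (simp only: a b c)
    ultimately show "m \<in> ?S" by simp
  qed
  then have "H = (\<Sum>m\<in>?S. Poly_Mapping.single m (Poly_Mapping.lookup H m))"
    by (intro poly3_eq_sum_single) auto
  also have "\<dots> = special_sextic (Poly_Mapping.lookup H (mon3 3 0 3)) (Poly_Mapping.lookup H (mon3 0 3 3))
      (Poly_Mapping.lookup H (mon3 3 3 0))"
    using one[of 1] one[of 2] one[of 3] unfolding mon3_single
    by (simp add: single_mon3 special_sextic_def algebra_simps)
  finally show ?thesis .
qed

lemma homogeneous3_special_sextic: "homogeneous3 6 (special_sextic a b c)"
proof -
  have eq: "special_sextic a b c = Poly_Mapping.single (mon3 6 0 0) 1 + Poly_Mapping.single (mon3 0 6 0) 1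
     + Poly_Mapping.single (mon3 0 0 6) 1 + Poly_Mapping.single (mon3 3 0 3) a
     + Poly_Mapping.single (mon3 0 3 3) b + Poly_Mapping.single (mon3 3 3 0) c"
    by (simp add: single_mon3 special_sextic_def algebra_simps)
  have "homogeneous3 6 (Poly_Mapping.single m x)" if "Poly_Mapping.lookup m 1 + Poly_Mapping.lookup m 2 + Poly_Mapping.lookup m 3 = 6"
    for m and x :: 'a
    using that by (simp add: homogeneous3_def sum_3)
  then show ?thesis
    unfolding eq by (intro homogeneous3_add) simp_all
qed

context cube_root
begin

text \<open>In the basis v, q, p, with v on both axes, the homologies become those of Y and Z, and
  modulo scalars they generate that of X. All exponents are then divisible by 3 and all pure sixth
  powers occur.\<close>

lemma orthogonal_homologies_special:
  assumes F: "smooth_plane_curve 6 F"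
    and r: "aut_matrix F (homology_matrix \<zeta> p f)" "pairing f p = 1"
    and r': "aut_matrix F (homology_matrix \<zeta> q g)" "pairing g q = 1"
    and orth: "pairing f q = 0" "pairing g p = 0"
  obtains \<alpha> \<beta> \<gamma> where "K_isomorphic F (special_sextic \<alpha> \<beta> \<gamma>)"
proof -
  obtain v where v: "v \<noteq> 0" "pairing f v = 0" "pairing g v = 0"
    by (rule common_kernel)
  define P :: "'a^3^3" where "P = (\<chi> i j. if j = 1 then v $ i else if j = 2 then q $ i else p $ i)"
  have Px: "P *v x = x $ 1 *s v + x $ 2 *s q + x $ 3 *s p" for x
    by (simp add: vec_eq_iff matrix_vector_mult_def sum_3 P_def algebra_simps)
  have fP: "pairing f (P *v x) = x $ 3" and gP: "pairing g (P *v x) = x $ 2" for x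
    by (simp_all add: Px pairing_add pairing_smult r r' orth v)
  have "x = 0" if x: "P *v x = 0" for x
  proof -
    have x23: "x $ 3 = 0" "x $ 2 = 0" using fP[of x] gP[of x] by (simp_all add: x pairing_0)
    have "x $ 1 *s v = 0" using Px[of x] by (simp add: x x23)
    then have "x $ 1 = 0" using v(1) by simp
    then show ?thesis using x23 by (simp add: vec_eq_iff forall_3)
  qed
  then obtain Q where Q: "Q ** P = mat 1"
    using matrix_left_invertible_ker by blast
  then have PQ: "P ** Q = mat 1" using matrix_left_right_inverse by blast
  have conj: "P ** coord_homology \<zeta> k ** Q = R" if "P ** coord_homology \<zeta> k = R ** P" for R k
  proof -
    have "P ** coord_homology \<zeta> k ** Q = R ** (P ** Q)"
      unfolding that by (rule matrix_mul_assoc[symmetric])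
    then show ?thesis by (simp add: PQ)
  qed
  have D3: "P ** coord_homology \<zeta> 3 = homology_matrix \<zeta> p f ** P"
    and D2: "P ** coord_homology \<zeta> 2 = homology_matrix \<zeta> q g ** P"
  proof -
    have C: "coord_homology \<zeta> k *v x = (\<chi> i. (if i = k then \<zeta> else 1) * x $ i)" for k x
      by (simp add: coord_homology_def vec_eq_iff matrix_vector_mult_def if_distrib[where f = "\<lambda>x. x * _"] cong: if_cong)
    have "P *v (coord_homology \<zeta> 3 *v x) = P *v x + ((\<zeta> - 1) * x $ 3) *s p"
      "P *v (coord_homology \<zeta> 2 *v x) = P *v x + ((\<zeta> - 1) * x $ 2) *s q" for x
      by (simp_all add: C Px) (simp_all add: vec_eq_iff algebra_simps)
    then have "P *v (coord_homology \<zeta> 3 *v x) = homology_matrix \<zeta> p f *v (P *v x)"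
      "P *v (coord_homology \<zeta> 2 *v x) = homology_matrix \<zeta> q g *v (P *v x)" for x
      by (simp_all only: homology_matrix_mult_vec fP gP)
    then show "P ** coord_homology \<zeta> 3 = homology_matrix \<zeta> p f ** P"
      "P ** coord_homology \<zeta> 2 = homology_matrix \<zeta> q g ** P"
      by (simp_all add: matrix_eq matrix_vector_mul_assoc)
  qed
  \<comment> \<open>The factor \<open>Const 1\<close> gives the shape expected by
    \<open>K_isomorphic\<close> and \<open>aut_matrix_lin_subst\<close>.\<close>
  define G where "G = Const 1 * lin_subst P F"
  have inv: "invertible P" using Q PQ by (auto simp: invertible_def)
  then have FG: "K_isomorphic F G"
    unfolding K_isomorphic_def G_def by (intro exI conjI) (assumption, rule one_neq_zero, rule refl)
  have G3: "aut_matrix G (coord_homology \<zeta> 3)" and G2: "aut_matrix G (coord_homology \<zeta> 2)"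
    unfolding G_def using r(1) r'(1) conj[OF D3] conj[OF D2]
    by (simp_all only: aut_matrix_lin_subst[OF _ PQ one_neq_zero])
  have smG: "smooth_plane_curve 6 G"
    using smooth_plane_curve_K_isomorphic F FG by blast
  then have homG: "homogeneous3 6 G" by (simp add: smooth_plane_curve_def)
  \<comment> \<open>The squares multiply to diag(1, \<zeta>^2, \<zeta>^2); the scalar \<zeta> turns
    this into diag(\<zeta>, 1, 1).\<close>
  have "mat \<zeta> ** ((coord_homology \<zeta> 2 ** coord_homology \<zeta> 2) ** (coord_homology \<zeta> 3 ** coord_homology \<zeta> 3))
      = coord_homology \<zeta> 1"
    unfolding coord_homology_def diag3_mult mat_eq_diag3 diag3_eq_iff
  proof
    fix i :: 3
    show "\<zeta> * ((if i = 2 then \<zeta> else 1) * (if i = 2 then \<zeta> else 1)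
        * ((if i = 3 then \<zeta> else 1) * (if i = 3 then \<zeta> else 1))) = (if i = 1 then \<zeta> else 1)"
      using exhaust_3[of i] zeta_cube by (elim disjE) (simp_all add: power3_eq_cube mult.assoc)
  qed
  then have G1: "aut_matrix G (coord_homology \<zeta> 1)"
    using aut_matrix_mult[OF aut_matrix_scalar[OF homG zeta_neq_0]
        aut_matrix_mult[OF aut_matrix_mult[OF G2 G2] aut_matrix_mult[OF G3 G3]]] by simp
  have Gk: "aut_matrix G (coord_homology \<zeta> k)" for k
    using G1 G2 G3 exhaust_3[of k] by auto
  \<comment> \<open>Sixth roots of the inverse leading coefficients, to normalise the pure powers to
    coefficient 1.\<close>
  have "\<exists>d. d ^ 6 = inverse (Poly_Mapping.lookup G (Poly_Mapping.single k 6))" for k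
    by (rule nth_root_exists) simp
  then obtain d where d: "\<And>k. d k ^ 6 = inverse (Poly_Mapping.lookup G (Poly_Mapping.single k 6))"
    by metis
  have nz: "Poly_Mapping.lookup G (Poly_Mapping.single k 6) \<noteq> 0" for k
    using coord_homology_keys(2)[OF smG Gk] .
  have "d k \<noteq> 0" for k
    using d[of k] nz[of k] by auto
  then have diag: "invertible (diag3 d)" by (rule invertible_diag3)
  define H where "H = Const 1 * lin_subst (diag3 d) G"
  from diag have "K_isomorphic G H"
    unfolding K_isomorphic_def H_def by (intro exI conjI) (assumption, rule one_neq_zero, rule refl)
  then have "K_isomorphic F H" using FG K_isomorphic_trans by blast
  have lookH: "Poly_Mapping.lookup H m = (\<Prod>i\<in>UNIV. d i ^ Poly_Mapping.lookup m i) * Poly_Mapping.lookup G m" for m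
    by (simp add: H_def lookup_lin_subst_diag3)
  have homH: "homogeneous3 6 H"
    using homogeneous3_lin_subst[OF homG] by (simp add: H_def)
  have dvdH: "3 dvd Poly_Mapping.lookup m i" if "m \<in> Poly_Mapping.keys H" for m i
  proof -
    have "m \<in> Poly_Mapping.keys G" using that by (auto simp: in_keys_iff lookH)
    then show ?thesis by (rule coord_homology_keys(1)[OF smG Gk])
  qed
  have oneH: "Poly_Mapping.lookup H (Poly_Mapping.single i 6) = 1" for i
  proof -
    have "(\<Prod>j\<in>UNIV. d j ^ Poly_Mapping.lookup (Poly_Mapping.single i 6) j)
        = (\<Prod>j\<in>UNIV. if j = i then d i ^ 6 else 1)"
      by (intro prod.cong) (auto simp: lookup_single when_def)
    then have "(\<Prod>j\<in>UNIV. d j ^ Poly_Mapping.lookup (Poly_Mapping.single i 6) j) = d i ^ 6"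
      by simp
    then show ?thesis using nz[of i] by (simp add: lookH d)
  qed
  show ?thesis
  proof (rule that)
    have "H = special_sextic (Poly_Mapping.lookup H (mon3 3 0 3)) (Poly_Mapping.lookup H (mon3 0 3 3))
      (Poly_Mapping.lookup H (mon3 3 3 0))"
      by (rule special_sextic_eqI[OF homH]) (fact dvdH, fact oneH)
    then show "K_isomorphic F (special_sextic (Poly_Mapping.lookup H (mon3 3 0 3)) (Poly_Mapping.lookup H (mon3 0 3 3))
      (Poly_Mapping.lookup H (mon3 3 3 0)))"
      using \<open>K_isomorphic F H\<close> by simp
  qed
qed

text \<open>If two parameters agree up to a sign \<open>\<epsilon>\<close>, the curve has the involution that swaps two coordinates and
  multiplies them by \<open>\<epsilon>\<close>. Multiplied with the homology of the third coordinate it has order 6.\<close>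

lemma special_sextic_pairwise_distinct:
  fixes a b c :: 'a
  assumes "aut_orders_le_3 (special_sextic a b c)"
  shows "pairwise_distinct_mod_sign a b c"
proof -
  define \<tau> :: "3 \<Rightarrow> 3 \<Rightarrow> 3 \<Rightarrow> 3" where "\<tau> i j k = (if k = i then j else if k = j then i else k)" for i j k
  \<comment> \<open>The third coordinate is multiplied by \<zeta>, so this is already the product of
    the involution and the homology; its square is diag(1, 1, \<zeta>^2) up to the order of
    coordinates.\<close>
  define A where "A i j \<epsilon> = monomial_matrix (\<tau> i j) (\<lambda>k. if k = i \<or> k = j then \<epsilon> else \<zeta>)" for i j and \<epsilon> :: 'a
  let ?S = "special_sextic a b c"
  have contra: "lin_subst (A i j \<epsilon>) ?S \<noteq> ?S" if "\<epsilon> = 1 \<or> \<epsilon> = -1" "i \<noteq> j" for i j \<epsilon>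
  proof
    assume inv: "lin_subst (A i j \<epsilon>) ?S = ?S"
    have sq: "A i j \<epsilon> ** A i j \<epsilon> = diag3 (\<lambda>k. if k = i \<or> k = j then 1 else \<zeta>\<^sup>2)"
    proof -
      have tt: "\<tau> i j (\<tau> i j k) = k" and t: "(\<tau> i j k = i \<or> \<tau> i j k = j) = (k = i \<or> k = j)" for k
        by (simp_all add: \<tau>_def)
      have "(if k = i \<or> k = j then \<epsilon> else \<zeta>) * (if k = i \<or> k = j then \<epsilon> else \<zeta>)
          = (if k = i \<or> k = j then 1 else \<zeta>\<^sup>2)" for k
        using that(1) by (auto simp: power2_eq_square)
      then show ?thesis
        unfolding A_def monomial_matrix_mult tt t monomial_matrix_id by simp
    qed
    have "invertible (A i j \<epsilon> ** A i j \<epsilon>)"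
      unfolding sq using zeta_neq_0 by (simp add: invertible_diag3_iff)
    then have "invertible (A i j \<epsilon>)" by (rule invertible_if_square)
    then have "aut_matrix ?S (A i j \<epsilon>)"
      using inv by (auto simp: aut_matrix_def intro!: exI[of _ 1])
    \<comment> \<open>Counting provides the third index k, where the square of the matrix has its
      different diagonal entry.\<close>
    have "card {i, j} < card (UNIV :: 3 set)"
      by (simp add: card_insert_if)
    then have "{i, j} \<noteq> UNIV" by (metis less_irrefl)
    then obtain k where "k \<noteq> i" "k \<noteq> j" by (metis UNIV_eq_I insertCI)
    have "A i j \<epsilon> $ i $ j \<noteq> 0" using that by (auto simp: A_def monomial_matrix_def \<tau>_def)
    have "\<not> aut_orders_le_3 ?S"
    proof (rule not_orders_le_3[OF \<open>aut_matrix ?S (A i j \<epsilon>)\<close> sq \<open>A i j \<epsilon> $ i $ j \<noteq> 0\<close> \<open>i \<noteq> j\<close>])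
      show "(if k = i \<or> k = j then 1 else \<zeta>\<^sup>2) \<noteq> (if i = i \<or> i = j then 1 else \<zeta>\<^sup>2)"
        using \<open>k \<noteq> i\<close> \<open>k \<noteq> j\<close> zeta_sq_neq_1 by simp
    qed simp
    then show False using assms by simp
  qed
  have z6: "\<zeta> ^ 6 = 1" using zeta_power_eq_1_iff by simp
  \<comment> \<open>Each swapped variable contributes \<open>\<epsilon> ^ 3 = \<epsilon>\<close>.
    The mixed term of both swapped variables keeps its coefficient, while the other two coefficients
    are exchanged up to \<epsilon>.\<close>
  have e3: "\<epsilon> ^ 6 = 1" "\<epsilon> ^ 3 = \<epsilon>" "\<epsilon> * \<epsilon> = 1" if "\<epsilon> = 1 \<or> \<epsilon> = -1" for \<epsilon> :: 'a
    using that by auto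
  have V: "lin_subst (A i j \<epsilon>) (Var k) = Const (if k = i \<or> k = j then \<epsilon> else \<zeta>) * Var (\<tau> i j k)" for i j k \<epsilon>
    by (simp add: A_def lin_subst_monomial_matrix)
  note simps = special_sextic_def lin_subst_add lin_subst_mult lin_subst_power lin_subst_Const V
    \<tau>_def power_mult_distrib Const_power[symmetric] z6 zeta_cube
  have CE: "Const \<epsilon> * Const \<epsilon> = 1" "Const \<epsilon> * (Const \<epsilon> * F) = F"
    if "\<epsilon> = 1 \<or> \<epsilon> = -1" for \<epsilon> :: 'a and F
    by (simp_all add: e3[OF that] flip: Const_mult mult.assoc)
  have 1: "a \<noteq> \<epsilon> * b" if "\<epsilon> = 1 \<or> \<epsilon> = -1" for \<epsilon>
  proof
    assume "a = \<epsilon> * b"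
    then have "b = \<epsilon> * a" using e3(3)[OF that] by (simp flip: mult.assoc)
    have "lin_subst (A 1 2 \<epsilon>) ?S = varX ^ 6 + varY ^ 6 + varZ ^ 6
       + varZ ^ 3 * (Const (\<epsilon> * b) * varX ^ 3 + Const (\<epsilon> * a) * varY ^ 3)
       + Const c * varX ^ 3 * varY ^ 3"
      by (simp add: simps e3[OF that]) (simp add: algebra_simps Const_mult CE[OF that])
    then have "lin_subst (A 1 2 \<epsilon>) ?S = ?S"
      by (simp only: special_sextic_def \<open>a = \<epsilon> * b\<close>[symmetric] \<open>b = \<epsilon> * a\<close>[symmetric])
    then show False using contra[OF that] by simp
  qed
  have 2: "b \<noteq> \<epsilon> * c" if "\<epsilon> = 1 \<or> \<epsilon> = -1" for \<epsilon>
  proof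
    assume "b = \<epsilon> * c"
    then have "c = \<epsilon> * b" using e3(3)[OF that] by (simp flip: mult.assoc)
    have "lin_subst (A 1 3 \<epsilon>) ?S = varX ^ 6 + varY ^ 6 + varZ ^ 6
       + varZ ^ 3 * (Const a * varX ^ 3 + Const (\<epsilon> * c) * varY ^ 3)
       + Const (\<epsilon> * b) * varX ^ 3 * varY ^ 3"
      by (simp add: simps e3[OF that]) (simp add: algebra_simps Const_mult CE[OF that])
    then have "lin_subst (A 1 3 \<epsilon>) ?S = ?S"
      by (simp only: special_sextic_def \<open>b = \<epsilon> * c\<close>[symmetric] \<open>c = \<epsilon> * b\<close>[symmetric])
    then show False using contra[OF that] by simp
  qed
  have 3: "a \<noteq> \<epsilon> * c" if "\<epsilon> = 1 \<or> \<epsilon> = -1" for \<epsilon>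
  proof
    assume "a = \<epsilon> * c"
    then have "c = \<epsilon> * a" using e3(3)[OF that] by (simp flip: mult.assoc)
    have "lin_subst (A 2 3 \<epsilon>) ?S = varX ^ 6 + varY ^ 6 + varZ ^ 6
       + varZ ^ 3 * (Const (\<epsilon> * c) * varX ^ 3 + Const b * varY ^ 3)
       + Const (\<epsilon> * a) * varX ^ 3 * varY ^ 3"
      by (simp add: simps e3[OF that]) (simp add: algebra_simps Const_mult CE[OF that])
    then have "lin_subst (A 2 3 \<epsilon>) ?S = ?S"
      by (simp only: special_sextic_def \<open>a = \<epsilon> * c\<close>[symmetric] \<open>c = \<epsilon> * a\<close>[symmetric])
    then show False using contra[OF that] by simp
  qed
  show ?thesis
    using 1[of 1] 1[of "-1"] 2[of 1] 2[of "-1"] 3[of 1] 3[of "-1"]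
    by (auto simp: pairwise_distinct_mod_sign_def)
qed

end

lemma pairing_axis_left: "pairing (axis i 1) x = x $ i"
  using exhaust_3[of i] by (auto simp: pairing_def sum_3 axis_def)

section \<open>Automorphism groups\<close>

text \<open>Trace 1 and determinant 0 describe a projection of rank one, hence a column times a row.
  These will be the centre and the axis of a homology.\<close>

lemma rank_one_idempotent:
  fixes a b c d :: "'a::field"
  assumes "a + d = 1" "a * d = b * c"
  obtains p\<^sub>1 p\<^sub>2 f\<^sub>1 f\<^sub>2 where "p\<^sub>1 * f\<^sub>1 = a" "p\<^sub>1 * f\<^sub>2 = b" "p\<^sub>2 * f\<^sub>1 = c" "p\<^sub>2 * f\<^sub>2 = d"
proof (cases "a = 0")
  case True
  then have "d = 1" "b * c = 0" using assms by simp_all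
  then show ?thesis using that[of b c 1 1] True by simp
next
  case False
  then show ?thesis using that[of a 1 "b / a" c] assms by (simp add: field_simps)
qed

text \<open>Supplies the eigenvalues of a 2 by 2 block from its trace and determinant.\<close>

lemma quadratic_roots:
  fixes t D :: "'a::alg_closed_field"
  obtains u w where "t = u + w" "D = u * w"
proof -
  obtain u where "poly [:D, - t, 1:] u = 0"
    using alg_closed_imp_poly_has_root[of "[:D, - t, 1:]"] by auto
  then have "D = u * (t - u)" by (simp add: algebra_simps eq_neg_iff_add_eq_0)
  then show ?thesis using that[of u "t - u"] by simp
qed

lemma coord_homology_nth: "coord_homology z k $ i $ j = (if i = j then if i = k then z else 1 else 0)"
  by (simp add: coord_homology_def)

lemma mult_coord_homology: "(A ** coord_homology z k) $ i $ j = (if j = k then z else 1) * A $ i $ j"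
  using exhaust_3[of j] by (elim disjE) (simp_all add: matrix_matrix_mult_def coord_homology_nth sum_3)

lemma coord_homology_mult: "(coord_homology z k ** A) $ i $ j = (if i = k then z else 1) * A $ i $ j"
  using exhaust_3[of i] by (elim disjE) (simp_all add: matrix_matrix_mult_def coord_homology_nth sum_3)

lemma coord_homology_prod: "coord_homology x k ** coord_homology y k = coord_homology (x * y) k"
  by (auto simp: coord_homology_def diag3_mult diag3_eq_iff)

lemma coord_homology_one: "coord_homology 1 k = mat 1"
  by (auto simp: coord_homology_def mat_eq_diag3 diag3_eq_iff)

lemma invertible_row_nonzero:
  fixes A :: "'a::field^'n^'n"
  assumes "invertible A"
  obtains k where "A $ i $ k \<noteq> 0"
proof (rule ccontr)
  assume "\<not> thesis"
  then have "row i A = 0" using that by (auto simp: row_def vec_eq_iff)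
  then have "det A = 0" by (rule det_zero_row)
  then show False using assms by (simp add: invertible_det_nz)
qed

lemma invertible_column_nonzero:
  fixes A :: "'a::field^'n^'n"
  assumes "invertible A"
  obtains k where "A $ k $ i \<noteq> 0"
proof (rule ccontr)
  assume "\<not> thesis"
  then have "column i A = 0" using that by (auto simp: column_def vec_eq_iff)
  then have "det A = 0" by (rule det_zero_column)
  then show False using assms by (simp add: invertible_det_nz)
qed

context cube_root
begin

definition cube_roots_one :: "'a set"
  where "cube_roots_one = {1, \<zeta>, \<zeta>\<^sup>2}"

lemma cube_roots_oneI: "x ^ 3 = 1 \<Longrightarrow> x \<in> cube_roots_one"
  using cube_eq_cases[of x 1] by (auto simp: cube_roots_one_def)

lemma aut_matrix_coord_homology:
  assumes "homogeneous3 d F" "aut_matrix F (coord_homology \<zeta> k)" "x \<in> cube_roots_one"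
  shows "aut_matrix F (coord_homology x k)"
proof -
  have "aut_matrix F (mat 1)" using aut_matrix_scalar[OF assms(1)] by simp
  moreover have "aut_matrix F (coord_homology (\<zeta> * \<zeta>) k)"
    using aut_matrix_mult[OF assms(2) assms(2)] by (simp only: coord_homology_prod)
  ultimately show ?thesis
    using assms by (auto simp: cube_roots_one_def coord_homology_one power2_eq_square)
qed

text \<open>If the upper left block is not scalar, its eigenvalues differ by a factor \<open>\<zeta>\<close>, and after
  multiplication by a power of the given homology \<open>A\<close> becomes, up to a scalar, a second homology,
  whose centre lies on the axis of the first one.\<close>

lemma block_automorphism_scalar_or_special:
  assumes F: "smooth_plane_curve 6 F" "aut_orders_le_3 F"
    and D: "aut_matrix F (coord_homology \<zeta> 3)"
    and A: "aut_matrix F A" "A $ 1 $ 3 = 0" "A $ 2 $ 3 = 0" "A $ 3 $ 1 = 0" "A $ 3 $ 2 = 0"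
    and A3: "is_scalar (A ** A ** A)"
    and no_special: "\<And>a b c. \<not> K_isomorphic F (special_sextic a b c)"
  shows "\<exists>s x. s \<noteq> 0 \<and> x \<in> cube_roots_one \<and> A = mat s ** coord_homology x 3"
proof -
  define a b c d e where abcde: "a = A $ 1 $ 1" "b = A $ 1 $ 2" "c = A $ 2 $ 1" "d = A $ 2 $ 2" "e = A $ 3 $ 3"
  have hom: "homogeneous3 6 F" using F by (simp add: smooth_plane_curve_def)
  have invA: "invertible A" using A by (simp add: aut_matrix_def)
  obtain k where "A $ 3 $ k \<noteq> 0" using invertible_row_nonzero[OF invA] .
  then have "e \<noteq> 0" using A exhaust_3[of k] abcde by auto
  obtain s where s: "A ** A ** A = mat s" using A3 by (auto simp: is_scalar_def)
  have ent: "(A ** A ** A) $ i $ j = (if i = j then s else 0)" for i j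
    by (simp add: s mat_def)
  have es: "e ^ 3 = s"
    using ent[of 3 3] A by (simp add: matrix_matrix_mult_def sum_3 abcde power3_eq_cube)
  then have "s \<noteq> 0" using \<open>e \<noteq> 0\<close> by auto
  \<comment> \<open>By Cayley-Hamilton the cube of the block is K times the block minus trace times
    determinant. If K is nonzero, the block must be scalar.\<close>
  define K where "K = (a + d)\<^sup>2 - (a * d - b * c)"
  have 1: "K * a - (a + d) * (a * d - b * c) = s" "K * b = 0" "K * c = 0"
    "K * d - (a + d) * (a * d - b * c) = s"
    using ent[of 1 1] ent[of 1 2] ent[of 2 1] ent[of 2 2] A
    by (simp_all add: matrix_matrix_mult_def sum_3 abcde[symmetric] K_def power2_eq_square algebra_simps)
  show ?thesis
  proof (cases "K = 0")
    case False
    then have bc: "b = 0" "c = 0" using 1 by simp_all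
    have "K * a = K * d" using 1(1,4) by (simp only: diff_eq_eq)
    then have "a = d" using False by simp
    have "a ^ 3 = s" using 1(1) bc \<open>a = d\<close> by (simp add: K_def power2_eq_square power3_eq_cube algebra_simps)
    then have "a \<noteq> 0" using es \<open>e \<noteq> 0\<close> by auto
    have "(e / a) ^ 3 = 1" using es \<open>a ^ 3 = s\<close> \<open>s \<noteq> 0\<close> by (simp add: power_divide)
    then have "e / a \<in> cube_roots_one" by (rule cube_roots_oneI)
    moreover have "A = mat a ** coord_homology (e / a) 3"
      using A bc \<open>a = d\<close> \<open>a \<noteq> 0\<close>
      by (simp add: vec_eq_iff forall_3 mat_mult_left coord_homology_nth abcde[symmetric])
    ultimately show ?thesis using \<open>a \<noteq> 0\<close> by blast
  next
    case True
    obtain u' w' where uw': "a + d = u' + w'" "a * d - b * c = u' * w'"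
      by (rule quadratic_roots)
    \<comment> \<open>In terms of the eigenvalues K is u'^2 + u'w' + w'^2, so K = 0 makes their
      ratio a primitive cube root of unity. After a possible exchange they are \<zeta>w and
      w.\<close>
    have "(u' - \<zeta> * w') * (u' - \<zeta>\<^sup>2 * w') = (u' + w')\<^sup>2 - u' * w'"
      by (simp add: power2_eq_square algebra_simps zeta_zeta zeta_zeta_left)
    then have "u' = \<zeta> * w' \<or> u' = \<zeta>\<^sup>2 * w'"
      using True by (simp add: K_def uw')
    moreover have "w' = \<zeta> * u'" if "u' = \<zeta>\<^sup>2 * w'"
      using zeta_cube that by (simp add: power2_eq_square power3_eq_cube mult.assoc[symmetric])
    ultimately obtain w where w: "a + d = \<zeta> * w + w" "a * d - b * c = \<zeta> * w * w"
      using uw' by (metis add.commute mult.commute)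
    have "- ((\<zeta> * w + w) * (\<zeta> * w * w)) = s" using 1(1) w True by simp
    moreover have "- ((\<zeta> * w + w) * (\<zeta> * w * w)) = w ^ 3"
      by (simp add: power3_eq_cube algebra_simps zeta_zeta zeta_zeta_left)
    ultimately have ws: "w ^ 3 = s" by simp
    then have "w \<noteq> 0" using es \<open>e \<noteq> 0\<close> by auto
    have "(w / e) ^ 3 = 1" using es ws \<open>s \<noteq> 0\<close> by (simp add: power_divide)
    then have "w / e \<in> cube_roots_one" by (rule cube_roots_oneI)
    \<comment> \<open>Division by w makes the eigenvalues of the block \<zeta> and 1; the homology
      with multiplier w/e makes the last entry 1.\<close>
    define B where "B = mat (inverse w) ** (A ** coord_homology (w / e) 3)"
    have B: "aut_matrix F B"
      unfolding B_def using \<open>w \<noteq> 0\<close>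
      by (intro aut_matrix_mult aut_matrix_scalar[OF hom] A aut_matrix_coord_homology[OF hom D]
           \<open>w / e \<in> cube_roots_one\<close>) simp
    have z1: "\<zeta> - 1 \<noteq> 0" using zeta_neq_1 by simp
    \<comment> \<open>The block of (B - 1)/(\<zeta> - 1), whose eigenvalues are 1 and 0.\<close>
    define a' b' c' d' where n: "a' = (a / w - 1) / (\<zeta> - 1)" "b' = b / w / (\<zeta> - 1)"
      "c' = c / w / (\<zeta> - 1)" "d' = (d / w - 1) / (\<zeta> - 1)"
    have dd: "d = \<zeta> * w + w - a" using w(1) by (simp add: algebra_simps)
    have "a' + d' = 1"
      using \<open>w \<noteq> 0\<close> z1 unfolding n dd by (simp add: divide_simps) (simp add: algebra_simps)
    moreover have "a' * d' = b' * c'"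
    proof -
      have "(a - w) * (d - w) = a * d - w * (a + d) + w * w" by (simp add: algebra_simps)
      also have "\<dots> = b * c"
        using w(2) unfolding w(1) by (simp add: algebra_simps)
      finally have "(a - w) * (d - w) = b * c" .
      then show ?thesis
        using \<open>w \<noteq> 0\<close> z1 unfolding n by (simp add: divide_simps)
    qed
    ultimately obtain p\<^sub>1 p\<^sub>2 f\<^sub>1 f\<^sub>2
      where pf: "p\<^sub>1 * f\<^sub>1 = a'" "p\<^sub>1 * f\<^sub>2 = b'" "p\<^sub>2 * f\<^sub>1 = c'" "p\<^sub>2 * f\<^sub>2 = d'"
      by (rule rank_one_idempotent)
    \<comment> \<open>The zero third coordinates make the new homology orthogonal to the given
      one.\<close>
    define p :: "'a^3" where "p = vector [p\<^sub>1, p\<^sub>2, 0]"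
    define f :: "'a^3" where "f = vector [f\<^sub>1, f\<^sub>2, 0]"
    have pv: "p $ 1 = p\<^sub>1" "p $ 2 = p\<^sub>2" "p $ 3 = 0" and fv: "f $ 1 = f\<^sub>1" "f $ 2 = f\<^sub>2" "f $ 3 = 0"
      by (simp_all add: p_def f_def)
    have "pairing f p = 1"
      using \<open>a' + d' = 1\<close> pf by (simp add: pairing_def sum_3 pv fv mult.commute)
    have zn: "(\<zeta> - 1) * a' = a / w - 1" "(\<zeta> - 1) * b' = b / w" "(\<zeta> - 1) * c' = c / w" "(\<zeta> - 1) * d' = d / w - 1"
      using z1 by (simp_all add: n)
    have zpf: "f\<^sub>1 * (p\<^sub>1 * (\<zeta> - 1)) = a * inverse w - 1" "f\<^sub>2 * (p\<^sub>1 * (\<zeta> - 1)) = b * inverse w"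
      "f\<^sub>1 * (p\<^sub>2 * (\<zeta> - 1)) = c * inverse w" "f\<^sub>2 * (p\<^sub>2 * (\<zeta> - 1)) = d * inverse w - 1"
      using zn unfolding pf[symmetric] divide_inverse by (simp_all only: ac_simps)
    have "B = homology_matrix \<zeta> p f"
      using A \<open>e \<noteq> 0\<close> \<open>w \<noteq> 0\<close>
      by (simp add: B_def vec_eq_iff forall_3 mat_mult_left mult_coord_homology homology_matrix_def
          pv fv zpf mult.assoc abcde[symmetric] divide_inverse mult.commute)
    then have "aut_matrix F (homology_matrix \<zeta> p f)" using B by simp
    moreover have "pairing f (axis 3 1) = 0" "pairing (axis 3 1) p = 0"
      "pairing (axis 3 1) (axis 3 (1::'a)) = 1"
      by (simp_all add: pairing_axis pairing_axis_left fv pv)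
    ultimately show ?thesis
      using orthogonal_homologies_special[OF F(1) _ \<open>pairing f p = 1\<close> D[unfolded coord_homology_eq]]
        no_special by metis
  qed
qed

text \<open>Conjugating the given homology by A yields a homology of the same curve. An orthogonal
  pair would make the curve special, so the two coincide. Thus A commutes with the homology, which
  gives the block shape.\<close>

lemma automorphisms_if_not_special:
  assumes F: "smooth_plane_curve 6 F" "aut_orders_le_3 F"
    and D: "aut_matrix F (coord_homology \<zeta> 3)" and A: "aut_matrix F A"
    and no_special: "\<And>a b c. \<not> K_isomorphic F (special_sextic a b c)"
  shows "\<exists>s x. s \<noteq> 0 \<and> x \<in> cube_roots_one \<and> A = mat s ** coord_homology x 3"
proof -
  let ?D = "coord_homology \<zeta> 3"
  obtain B where AB: "A ** B = mat 1" and BA: "B ** A = mat 1"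
    using A by (auto simp: aut_matrix_def invertible_def)
  have ax: "pairing (axis 3 1) (axis 3 (1::'a)) = 1" by (simp only: pairing_axis) simp
  have conj: "A ** ?D ** B = homology_matrix \<zeta> (A *v axis 3 1) (axis 3 1 v* B)"
    unfolding coord_homology_eq by (rule homology_matrix_conj[OF AB])
  have aut: "aut_matrix F (A ** ?D ** B)"
    using A D aut_matrix_inverse[OF A AB] by (intro aut_matrix_mult)
  have one: "pairing (axis 3 1 v* B) (A *v axis 3 (1::'a)) = 1"
    using pairing_conj[OF AB] ax by simp
  have "\<not> (pairing (axis 3 1) (A *v axis 3 1) = 0 \<and> pairing (axis 3 1 v* B) (axis 3 1) = 0)"
    using orthogonal_homologies_special[OF F(1) D[unfolded coord_homology_eq] ax aut[unfolded conj] one]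
      no_special by blast
  then have "?D = homology_matrix \<zeta> (A *v axis 3 1) (axis 3 1 v* B)"
    using homologies_equal_or_orthogonal[OF F(2) D[unfolded coord_homology_eq] ax aut[unfolded conj] one]
    unfolding coord_homology_eq by blast
  then have "A ** ?D ** B = ?D" by (rule trans[OF conj sym])
  then have "A ** ?D ** B ** A = ?D ** A" by simp
  then have comm: "A ** ?D = ?D ** A"
    by (simp add: BA flip: matrix_mul_assoc)
  have "A $ i $ j = 0" if "i = 3 \<longleftrightarrow> j \<noteq> 3" for i j
    using arg_cong[OF comm, of "\<lambda>M. M $ i $ j"] that zeta_neq_1
    by (cases "i = 3") (auto simp: mult_coord_homology coord_homology_mult)
  then have "A $ 1 $ 3 = 0" "A $ 2 $ 3 = 0" "A $ 3 $ 1 = 0" "A $ 3 $ 2 = 0" by simp_all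
  then show ?thesis
    using block_automorphism_scalar_or_special[OF F D A _ _ _ _ commuting_cube_scalar[OF F(2) A D comm] no_special]
    by simp
qed

end

lemma eval3_special_sextic: "eval3 (special_sextic a b c) v
  = v $ 1 ^ 6 + v $ 2 ^ 6 + v $ 3 ^ 6 + v $ 3 ^ 3 * (a * v $ 1 ^ 3 + b * v $ 2 ^ 3) + c * v $ 1 ^ 3 * v $ 2 ^ 3"
  by (simp add: special_sextic_def eval3_simps)

lemma monomial_matrix_mult_vec: "(monomial_matrix \<tau> d *v v) $ i = d i * v $ \<tau> i"
  by (simp add: monomial_matrix_def matrix_vector_mult_def if_distrib[where f = "\<lambda>x. x * _"] cong: if_cong)

text \<open>On the coordinate line through the points i and j the form is x^6 + y^6 + \<beta> x^3
  y^3. Diagonal scalings compatible with both sixth powers change \<beta> at most by a sign. The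
  three squares are distinct, so \<tau> preserves every pair of indices, hence every index.\<close>

lemma monomial_automorphism_special:
  fixes a b c :: "'a::field"
  assumes A: "aut_matrix (special_sextic a b c) (monomial_matrix \<tau> d)"
    and inj: "inj \<tau>" and distinct: "pairwise_distinct_mod_sign a b c"
  shows "\<tau> i = i"
proof -
  let ?S = "special_sextic a b c" and ?A = "monomial_matrix \<tau> d"
  obtain k where "lin_subst ?A ?S = Const k * ?S" "k \<noteq> 0"
    using A by (auto simp: aut_matrix_def)
  then have ev: "eval3 ?S (?A *v v) = k * eval3 ?S v" for v
    using eval3_lin_subst[of ?A ?S v] by (simp add: eval3_simps)
  \<comment> \<open>For i \<noteq> j this is the coefficient attached to the cubes of the i-th and
    j-th variables; the value for i = j is arbitrary.\<close>
  define \<beta> :: "3 \<Rightarrow> 3 \<Rightarrow> 'a" where "\<beta> i j = (if i \<noteq> 1 \<and> j \<noteq> 1 then b else if i \<noteq> 2 \<and> j \<noteq> 2 then a else c)" for i j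
  define pt :: "3 \<Rightarrow> 3 \<Rightarrow> 'a \<Rightarrow> 'a \<Rightarrow> 'a^3"
    where "pt i j x y = (\<chi> l. if l = i then x else if l = j then y else 0)" for i j x y
  have S: "eval3 ?S (pt i j x y) = x ^ 6 + y ^ 6 + \<beta> i j * x ^ 3 * y ^ 3" if "i \<noteq> j" for i j x y
    using that exhaust_3[of i] exhaust_3[of j]
    by (auto simp: eval3_special_sextic pt_def \<beta>_def)
  have A_pt: "?A *v pt (\<tau> i) (\<tau> j) x y = pt i j (d i * x) (d j * y)" if "i \<noteq> j" for i j x y
    using inj that by (auto simp: vec_eq_iff monomial_matrix_mult_vec pt_def inj_eq)
  have sq: "(\<beta> i j)\<^sup>2 = (\<beta> (\<tau> i) (\<tau> j))\<^sup>2" if "i \<noteq> j" for i j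
  proof -
    have "\<tau> i \<noteq> \<tau> j" using inj that by (auto simp: inj_eq)
    have e: "(d i * x) ^ 6 + (d j * y) ^ 6 + \<beta> i j * (d i * x) ^ 3 * (d j * y) ^ 3
        = k * (x ^ 6 + y ^ 6 + \<beta> (\<tau> i) (\<tau> j) * x ^ 3 * y ^ 3)" for x y
      using ev[of "pt (\<tau> i) (\<tau> j) x y"] by (simp only: A_pt[OF that] S[OF that] S[OF \<open>\<tau> i \<noteq> \<tau> j\<close>])
    have di: "d i ^ 6 = k" and dj: "d j ^ 6 = k" using e[of 1 0] e[of 0 1] by simp_all
    have "\<beta> i j * d i ^ 3 * d j ^ 3 = k * \<beta> (\<tau> i) (\<tau> j)"
      using e[of 1 1] by (simp add: di dj algebra_simps)
    then have "k\<^sup>2 * (\<beta> (\<tau> i) (\<tau> j))\<^sup>2 = (\<beta> i j * d i ^ 3 * d j ^ 3)\<^sup>2"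
      by (simp only: power_mult_distrib)
    also have "\<dots> = (\<beta> i j)\<^sup>2 * d i ^ 6 * d j ^ 6"
      by (simp add: power_mult_distrib flip: power_mult)
    also have "\<dots> = k\<^sup>2 * (\<beta> i j)\<^sup>2"
      unfolding di dj by (simp add: power2_eq_square)
    finally have "k\<^sup>2 * (\<beta> i j)\<^sup>2 = k\<^sup>2 * (\<beta> (\<tau> i) (\<tau> j))\<^sup>2" by (rule sym)
    then show ?thesis using \<open>k \<noteq> 0\<close> by simp
  qed
  have ne: "a\<^sup>2 \<noteq> b\<^sup>2" "a\<^sup>2 \<noteq> c\<^sup>2" "b\<^sup>2 \<noteq> c\<^sup>2"
    using distinct by (auto simp: pairwise_distinct_mod_sign_def power2_eq_iff)
  have \<beta>: "\<beta> 1 2 = c" "\<beta> 2 1 = c" "\<beta> 1 3 = a" "\<beta> 3 1 = a" "\<beta> 2 3 = b" "\<beta> 3 2 = b"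
    by (simp_all add: \<beta>_def)
  have pairs: "i = i' \<and> j = j' \<or> i = j' \<and> j = i'"
    if sq: "(\<beta> i j)\<^sup>2 = (\<beta> i' j')\<^sup>2" and "i \<noteq> j" "i' \<noteq> j'" for i j i' j'
  proof -
    have "i = 1 \<and> j = 2 \<or> i = 2 \<and> j = 1 \<or> i = 1 \<and> j = 3 \<or> i = 3 \<and> j = 1 \<or> i = 2 \<and> j = 3 \<or> i = 3 \<and> j = 2"
      if "i \<noteq> j" for i j :: 3
      using that exhaust_3 by metis
    from this[OF \<open>i \<noteq> j\<close>] this[OF \<open>i' \<noteq> j'\<close>] show ?thesis
      using sq by (elim disjE conjE) (simp_all add: \<beta> ne ne[symmetric])
  qed
  have \<tau>_ne: "\<tau> 1 \<noteq> \<tau> 2" "\<tau> 1 \<noteq> \<tau> 3" "\<tau> 2 \<noteq> \<tau> 3"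
    using inj by (simp_all add: inj_eq)
  have "\<tau> 1 = 1 \<and> \<tau> 2 = 2 \<and> \<tau> 3 = 3"
    using pairs[OF sq[of 1 2]] pairs[OF sq[of 1 3]] pairs[OF sq[of 2 3]] \<tau>_ne by auto
  then show ?thesis using exhaust_3[of i] by auto
qed

context cube_root
begin

lemma coord_homology_special_sextic: "aut_matrix (special_sextic a b c) (coord_homology \<zeta> k)"
proof -
  have z6: "\<zeta> ^ 6 = 1" using zeta_power_eq_1_iff by simp
  have "lin_subst (coord_homology \<zeta> k) (special_sextic a b c) = special_sextic a b c"
    using exhaust_3[of k]
    by (elim disjE) (simp_all add: special_sextic_def lin_subst_add lin_subst_mult lin_subst_power lin_subst_Const
        coord_homology_def lin_subst_diag3_Var power_mult_distrib z6 zeta_cube flip: Const_power)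
  moreover have "invertible (coord_homology \<zeta> k)"
    using zeta_neq_0 by (simp add: coord_homology_def invertible_diag3_iff)
  ultimately show ?thesis by (auto simp: aut_matrix_def intro!: exI[of _ 1])
qed

text \<open>Conjugation by A takes the j-th coordinate homology to one whose axis form is row j of
  A. A nonzero entry in column i excludes orthogonality to the i-th coordinate homology, so the two
  are equal. Comparing entries leaves a single nonzero entry in each row.\<close>

lemma automorphisms_special_sextic:
  fixes a b c :: 'a
  defines "S \<equiv> special_sextic a b c"
  assumes S: "aut_orders_le_3 S" and distinct: "pairwise_distinct_mod_sign a b c"
    and A: "aut_matrix S A"
  shows "\<exists>s x y. s \<noteq> 0 \<and> x \<in> cube_roots_one \<and> y \<in> cube_roots_one
    \<and> A = mat s ** (coord_homology x 2 ** coord_homology y 3)"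
proof -
  note D = coord_homology_special_sextic[of a b c, folded S_def]
  have invA: "invertible A" using A by (simp add: aut_matrix_def)
  obtain B where AB: "A ** B = mat 1" and BA: "B ** A = mat 1"
    using A by (auto simp: aut_matrix_def invertible_def)
  have B: "aut_matrix S B" using aut_matrix_inverse[OF A AB] .
  have ax: "pairing (axis i 1) (axis i (1::'a)) = 1" for i by (simp only: pairing_axis) simp
  have "\<exists>i. \<forall>k. k \<noteq> i \<longrightarrow> A $ j $ k = 0" for j
  proof -
    obtain i where i: "A $ j $ i \<noteq> 0" using invertible_row_nonzero[OF invA] .
    have conj: "B ** coord_homology \<zeta> j ** A = homology_matrix \<zeta> (B *v axis j 1) (axis j 1 v* A)"
      unfolding coord_homology_eq by (rule homology_matrix_conj[OF BA])
    have aut: "aut_matrix S (B ** coord_homology \<zeta> j ** A)"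
      using A B D by (intro aut_matrix_mult)
    have one: "pairing (axis j 1 v* A) (B *v axis j (1::'a)) = 1"
      using pairing_conj[OF BA] ax by simp
    have "(axis j 1 v* A) $ i = A $ j $ i"
      using exhaust_3[of j] by (auto simp: vector_matrix_mult_def sum_3 axis_def)
    then have "pairing (axis j 1 v* A) (axis i 1) \<noteq> 0" using i by (simp add: pairing_axis)
    then have "coord_homology \<zeta> i = homology_matrix \<zeta> (B *v axis j 1) (axis j 1 v* A)"
      using homologies_equal_or_orthogonal[OF S D[unfolded coord_homology_eq] ax aut[unfolded conj] one]
      unfolding coord_homology_eq by blast
    then have "B ** coord_homology \<zeta> j ** A = coord_homology \<zeta> i" by (rule trans[OF conj sym])
    then have "A ** (B ** coord_homology \<zeta> j ** A) = A ** coord_homology \<zeta> i" by simp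
    then have comm: "coord_homology \<zeta> j ** A = A ** coord_homology \<zeta> i"
      by (simp add: AB matrix_mul_assoc)
    have "A $ j $ k = 0" if "k \<noteq> i" for k
      using arg_cong[OF comm, of "\<lambda>M. M $ j $ k"] that zeta_neq_1
      by (simp add: mult_coord_homology coord_homology_mult)
    then show ?thesis by blast
  qed
  then obtain \<tau> where \<tau>: "\<And>j k. k \<noteq> \<tau> j \<Longrightarrow> A $ j $ k = 0" by metis
  define d where "d j = A $ j $ \<tau> j" for j
  have mono: "A = monomial_matrix \<tau> d"
    using \<tau> by (auto simp: vec_eq_iff monomial_matrix_def d_def)
  have "surj \<tau>"
  proof -
    have "i \<in> range \<tau>" for i
    proof -
      obtain k where "A $ k $ i \<noteq> 0" using invertible_column_nonzero[OF invA] .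
      then show ?thesis using \<tau>[of i k] by blast
    qed
    then show ?thesis by blast
  qed
  then have "inj \<tau>" by (simp add: finite_UNIV_surj_inj)
  then have "\<tau> i = i" for i
    using monomial_automorphism_special[OF A[unfolded S_def mono] _ distinct] by simp
  then have "\<tau> = (\<lambda>i. i)" by auto
  then have diag: "A = diag3 d" using mono by (simp add: monomial_matrix_id)
  have "d i \<noteq> 0" for i using invA by (simp add: diag invertible_diag3_iff)
  have "is_scalar (A ** A ** A)"
    by (rule commuting_cube_scalar[OF S A D[of 3]])
      (simp add: diag coord_homology_def diag3_mult mult.commute)
  then obtain s where "d i ^ 3 = s" for i
    by (auto simp: is_scalar_def diag diag3_mult mat_eq_diag3 diag3_eq_iff power3_eq_cube)
  then have "(d i / d 1) ^ 3 = 1" for i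
    using \<open>\<And>i. d i \<noteq> 0\<close> by (metis divide_self_if power_divide power_not_zero)
  then have "d i / d 1 \<in> cube_roots_one" for i by (rule cube_roots_oneI)
  moreover have "A = mat (d 1) ** (coord_homology (d 2 / d 1) 2 ** coord_homology (d 3 / d 1) 3)"
    unfolding diag coord_homology_def diag3_mult mat_eq_diag3 diag3_eq_iff forall_3
    using \<open>\<And>i. d i \<noteq> 0\<close> by simp
  ultimately show ?thesis using \<open>\<And>i. d i \<noteq> 0\<close> by blast
qed

section \<open>The normal form of a sextic with a homology of period 3\<close>

lemma normal_sextic_automorphism:
  assumes "binary_form_XY 3 L3" "binary_form_XY 6 L6"
  shows "aut_matrix (normal_sextic L3 L6) (coord_homology \<zeta> 3)"
proof -
  have L: "lin_subst (coord_homology \<zeta> 3) L = L" if "binary_form_XY n L" for n L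
  proof (rule poly_mapping_eqI)
    fix m
    show "Poly_Mapping.lookup (lin_subst (coord_homology \<zeta> 3) L) m = Poly_Mapping.lookup L m"
      using that
      by (cases "m \<in> Poly_Mapping.keys L")
        (auto simp: coord_homology_def lookup_lin_subst_diag3 prod_3 binary_form_XY_def in_keys_iff)
  qed
  have z6: "\<zeta> ^ 6 = 1" using zeta_power_eq_1_iff by simp
  have "lin_subst (coord_homology \<zeta> 3) varZ = Const \<zeta> * varZ"
    by (simp add: coord_homology_def lin_subst_diag3_Var)
  then have "lin_subst (coord_homology \<zeta> 3) (normal_sextic L3 L6) = normal_sextic L3 L6"
    by (simp add: normal_sextic_def lin_subst_add lin_subst_mult lin_subst_power L[OF assms(1)] L[OF assms(2)]
       power_mult_distrib z6 zeta_cube flip: Const_power)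
  moreover have "invertible (coord_homology \<zeta> 3)"
    using zeta_neq_0 by (simp add: coord_homology_def invertible_diag3_iff)
  ultimately show ?thesis by (auto simp: aut_matrix_def intro!: exI[of _ 1])
qed

text \<open>The exponents of Z are 0, 3 or 6. The part without Z is nonzero because smoothness at
  (1,0,0) requires a monomial with X-exponent at least 5. If the part with Z^3 vanished, multiplying
  Z by -\<zeta> would be an automorphism of order 6.\<close>

lemma normal_form:
  assumes F: "smooth_plane_curve 6 F" "aut_orders_le_3 F" "aut_matrix F (coord_homology \<zeta> 3)"
  shows "\<exists>L3 L6. binary_form_XY 3 L3 \<and> binary_form_XY 6 L6 \<and> L3 \<noteq> 0 \<and> L6 \<noteq> 0
            \<and> K_isomorphic F (normal_sextic L3 L6)"
proof -
  define u where "u = Poly_Mapping.lookup F (Poly_Mapping.single 3 6)"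
  have u: "u \<noteq> 0" unfolding u_def by (rule coord_homology_keys(2)[OF F(1,3)])
  have deg: "Poly_Mapping.lookup m 1 + Poly_Mapping.lookup m 2 + Poly_Mapping.lookup m 3 = 6"
    if "m \<in> Poly_Mapping.keys F" for m
    using F that by (auto simp: smooth_plane_curve_def homogeneous3_def sum_3)
  have m3: "Poly_Mapping.lookup m 3 = 0 \<or> Poly_Mapping.lookup m 3 = 3 \<or> Poly_Mapping.lookup m 3 = 6"
    if "m \<in> Poly_Mapping.keys F" for m
  proof -
    have "3 dvd Poly_Mapping.lookup m 3" by (rule coord_homology_keys(1)[OF F(1,3) that])
    then obtain k where "Poly_Mapping.lookup m 3 = 3 * k" by (rule dvdE)
    moreover from this have "k \<le> 2" using deg[OF that] by simp
    then have "k = 0 \<or> k = 1 \<or> k = 2" by linarith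
    ultimately show ?thesis by auto
  qed
  define K where "K n = {m \<in> Poly_Mapping.keys F. Poly_Mapping.lookup m 3 = n}" for n
  \<comment> \<open>The index is the exponent of Z, not the degree: \<open>L 0\<close> becomes the
    sextic and \<open>L 3\<close> the cubic form, both after division by u.\<close>
  define L where "L n = (\<Sum>m\<in>K n. Poly_Mapping.single (m - Poly_Mapping.single 3 n) (Poly_Mapping.lookup F m))" for n
  have finK: "finite (K n)" for n by (simp add: K_def)
  have ZL: "varZ ^ n * L n = (\<Sum>m\<in>K n. Poly_Mapping.single m (Poly_Mapping.lookup F m))" for n
  proof -
    have V: "varZ ^ n = Poly_Mapping.single (Poly_Mapping.single 3 n) (1::'a)"
      by (simp add: single_eq_Const_mult prod_3 lookup_single)
    show ?thesis
      unfolding L_def sum_distrib_left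
    proof (rule sum.cong[OF refl])
      fix m assume "m \<in> K n"
      then have "Poly_Mapping.single 3 n + (m - Poly_Mapping.single 3 n) = m"
        by (intro poly_mapping_eqI) (auto simp: lookup_add lookup_minus lookup_single when_def K_def)
      then show "varZ ^ n * Poly_Mapping.single (m - Poly_Mapping.single 3 n) (Poly_Mapping.lookup F m)
          = Poly_Mapping.single m (Poly_Mapping.lookup F m)"
        by (simp add: V mult_single)
    qed
  qed
  have bin: "binary_form_XY (6 - n) (Const k * L n)" for n k
  proof -
    have "Poly_Mapping.keys (L n) \<subseteq> (\<lambda>m. m - Poly_Mapping.single 3 n) ` K n"
      unfolding L_def using keys_sum by (rule order_trans) (auto split: if_splits)
    moreover have "Poly_Mapping.keys (Const k * L n) \<subseteq> Poly_Mapping.keys (L n)"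
      by (auto simp: in_keys_iff lookup_Const_mult)
    ultimately have sub: "Poly_Mapping.keys (Const k * L n) \<subseteq> (\<lambda>m. m - Poly_Mapping.single 3 n) ` K n" by blast
    have "(\<Sum>i\<in>UNIV. Poly_Mapping.lookup x i) = 6 - n \<and> Poly_Mapping.lookup x 3 = 0"
      if x: "x \<in> Poly_Mapping.keys (Const k * L n)" for x
    proof -
      obtain m where m: "m \<in> K n" "x = m - Poly_Mapping.single 3 n" using sub x by blast
      then show ?thesis
        using deg[of m] by (auto simp: sum_3 lookup_minus lookup_single K_def)
    qed
    then show ?thesis
      by (simp add: binary_form_XY_def homogeneous3_def)
  qed
  have K: "Poly_Mapping.keys F = K 6 \<union> K 3 \<union> K 0"
    using m3 unfolding K_def by blast
  have "F = (\<Sum>m\<in>Poly_Mapping.keys F. Poly_Mapping.single m (Poly_Mapping.lookup F m))"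
    by (rule poly3_eq_sum_single) simp_all
  also have "\<dots> = varZ ^ 6 * L 6 + varZ ^ 3 * L 3 + varZ ^ 0 * L 0"
    unfolding ZL K
  proof -
    have "(K 6 \<union> K 3) \<inter> K 0 = {}" "K 6 \<inter> K 3 = {}" by (auto simp: K_def)
    then show "(\<Sum>m\<in>K 6 \<union> K 3 \<union> K 0. Poly_Mapping.single m (Poly_Mapping.lookup F m))
      = (\<Sum>m\<in>K 6. Poly_Mapping.single m (Poly_Mapping.lookup F m))
        + (\<Sum>m\<in>K 3. Poly_Mapping.single m (Poly_Mapping.lookup F m))
        + (\<Sum>m\<in>K 0. Poly_Mapping.single m (Poly_Mapping.lookup F m))"
      by (simp only: sum.union_disjoint finK finite_UnI)
  qed
  finally have F_eq: "F = varZ ^ 6 * L 6 + varZ ^ 3 * L 3 + L 0" by simp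
  have "K 6 = {Poly_Mapping.single 3 6}"
  proof -
    have "m = Poly_Mapping.single 3 6" if "m \<in> K 6" for m
    proof -
      have "Poly_Mapping.lookup m 1 = 0" "Poly_Mapping.lookup m 2 = 0" "Poly_Mapping.lookup m 3 = 6"
        using that deg[of m] by (auto simp: K_def)
      then show ?thesis using mon3_lookup[of m] by (simp add: mon3_single)
    qed
    moreover have "Poly_Mapping.single 3 6 \<in> K 6"
      using u by (simp add: K_def u_def in_keys_iff)
    ultimately show ?thesis by blast
  qed
  then have L6: "L 6 = Const u" by (simp add: L_def u_def Const_def)
  let ?c = "inverse u"
  let ?N = "normal_sextic (Const ?c * L 3) (Const ?c * L 0)"
  have cu: "Const ?c * Const u = (1 :: 'a poly3)" using u by (simp flip: Const_mult)
  have lookL: "Poly_Mapping.lookup F m = 0" if "Const ?c * L n = 0" "m \<in> K n" for m n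
  proof -
    have "L n = (Const ?c * Const u) * L n" by (simp only: cu mult_1_left)
    also have "\<dots> = Const u * (Const ?c * L n)" by (simp only: mult_ac)
    finally have "L n = 0" by (simp only: that mult_zero_right)
    then have "(\<Sum>m\<in>K n. Poly_Mapping.single m (Poly_Mapping.lookup F m)) = 0"
      using ZL[of n] by simp
    from arg_cong[OF this, of "\<lambda>G. Poly_Mapping.lookup G m"] show ?thesis
      using that finK by (simp add: lookup_sum lookup_single when_def)
  qed
  from cu have "Const ?c * (varZ ^ 6 * Const u) = varZ ^ 6"
    by (simp add: mult.left_commute)
  then have "?N = Const ?c * F"
    unfolding normal_sextic_def F_eq L6 by (simp only: distrib_left mult.left_commute[of "varZ ^ 3"])
  then have "K_isomorphic F ?N"
    unfolding K_isomorphic_def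
    by (intro exI[of _ "mat 1"] exI[of _ ?c] conjI) (use u in \<open>simp_all add: invertible_mat\<close>)
  moreover have "Const ?c * L 0 \<noteq> 0"
  proof
    assume 0: "Const ?c * L 0 = 0"
    have "K 0 \<noteq> {}"
    proof -
      obtain m where m: "m \<in> Poly_Mapping.keys F" "6 \<le> Suc (Poly_Mapping.lookup m 1)"
        using smooth_plane_curve_corner[OF F(1)] .
      then have "m \<in> K 0" using m3[OF m(1)] deg[OF m(1)] by (auto simp: K_def)
      then show ?thesis by blast
    qed
    then obtain m where m: "m \<in> K 0" by blast
    then show False using lookL[OF 0 m] by (simp add: K_def in_keys_iff)
  qed
  moreover have "Const ?c * L 3 \<noteq> 0"
  proof
    assume 0: "Const ?c * L 3 = 0"
    have K3: "K 3 = {}"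
    proof (rule ccontr)
      assume "K 3 \<noteq> {}"
      then obtain m where m: "m \<in> K 3" by blast
      then show False using lookL[OF 0 m] by (simp add: K_def in_keys_iff)
    qed
    let ?E = "coord_homology (- \<zeta>) 3"
    have z6: "\<zeta> ^ 6 = 1" using zeta_power_eq_1_iff by simp
    have "lin_subst ?E F = F"
    proof (rule poly_mapping_eqI)
      fix m
      show "Poly_Mapping.lookup (lin_subst ?E F) m = Poly_Mapping.lookup F m"
      proof (cases "m \<in> Poly_Mapping.keys F")
        case True
        then have "Poly_Mapping.lookup m 3 = 0 \<or> Poly_Mapping.lookup m 3 = 6"
          using m3[OF True] K3 by (auto simp: K_def)
        then show ?thesis
          using z6 by (auto simp: coord_homology_def lookup_lin_subst_diag3 prod_3)
      qed (simp add: coord_homology_def lookup_lin_subst_diag3 in_keys_iff)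
    qed
    moreover have "invertible ?E"
      using zeta_neq_0 by (simp add: coord_homology_def invertible_diag3_iff)
    ultimately have "aut_matrix F ?E" by (auto simp: aut_matrix_def intro!: exI[of _ 1])
    then have "is_scalar ?E \<or> is_scalar (?E ** ?E) \<or> is_scalar (?E ** ?E ** ?E)"
      using F(2) by (auto simp: aut_orders_le_3_def)
    then have "- \<zeta> = 1 \<or> \<zeta> * \<zeta> = 1 \<or> - (\<zeta> * \<zeta> * \<zeta>) = 1"
      unfolding coord_homology_prod by (auto simp: is_scalar_def coord_homology_def mat_eq_diag3 diag3_eq_iff forall_3)
    moreover have "- \<zeta> \<noteq> 1"
    proof
      assume "- \<zeta> = 1"
      then have "\<zeta> = -1" by (metis minus_minus)
      then show False using zeta_sq_neq_1 by simp
    qed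
    moreover have "\<zeta> * \<zeta> * \<zeta> = 1" using zeta_cube by (simp add: power3_eq_cube)
    moreover have "- 1 \<noteq> (1::'a)" using two_nz by (metis add.right_inverse one_add_one)
    ultimately show False using zeta_sq_neq_1 by (auto simp: power2_eq_square)
  qed
  moreover have "binary_form_XY 3 (Const ?c * L 3)" "binary_form_XY 6 (Const ?c * L 0)"
    using bin[of 3 ?c] bin[of 0 ?c] by simp_all
  ultimately show ?thesis by blast
qed


section \<open>Automorphism groups as generated subgroups of the projective linear group\<close>

lemma coord_homology_in_generate:
  assumes "x \<in> cube_roots_one" "proj_class (coord_homology \<zeta> k) \<in> S"
  shows "proj_class (coord_homology x k) \<in> generate PGL3 S"
proof -
  have inv: "invertible (coord_homology \<zeta> k)"
    using zeta_neq_0 by (simp add: coord_homology_def invertible_diag3_iff)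
  have 1: "proj_class (coord_homology \<zeta> k) \<in> generate PGL3 S"
    using assms(2) by (rule generate.incl)
  have "proj_class (coord_homology \<zeta> k) \<otimes>\<^bsub>PGL3\<^esub> proj_class (coord_homology \<zeta> k) \<in> generate PGL3 S"
    using 1 1 by (rule generate.eng)
  then have 2: "proj_class (coord_homology (\<zeta> * \<zeta>) k) \<in> generate PGL3 S"
    by (simp add: proj_class_mult inv coord_homology_prod)
  have "proj_class (coord_homology 1 k) \<in> generate PGL3 S"
    using generate.one[of PGL3 S] by (simp add: one_PGL3 coord_homology_one)
  then show ?thesis
    using assms(1) 1 2 by (auto simp: cube_roots_one_def power2_eq_square)
qed

lemma generate_subset_Aut:
  assumes "homogeneous3 d F" "\<And>\<sigma>. \<sigma> \<in> S \<Longrightarrow> \<exists>k. \<sigma> = proj_class (coord_homology \<zeta> k) \<and> aut_matrix F (coord_homology \<zeta> k)"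
  shows "generate PGL3 S \<subseteq> Aut F"
proof -
  interpret group "PGL3 :: ('a^3^3) set monoid" by (rule group_PGL3)
  have "S \<subseteq> Aut F" using assms(2) by (auto simp: Aut_eq)
  then show ?thesis by (rule generate_subgroup_incl) (rule subgroup_Aut[OF assms(1)])
qed

lemma Aut_normal_sextic:
  assumes N: "smooth_plane_curve 6 (normal_sextic L3 L6)" "aut_orders_le_3 (normal_sextic L3 L6)"
    and L: "binary_form_XY 3 L3" "binary_form_XY 6 L6"
    and no_special: "\<And>a b c. \<not> K_isomorphic (normal_sextic L3 L6) (special_sextic a b c)"
  shows "Aut (normal_sextic L3 L6) = rho1_Z3 \<zeta>"
proof
  note D = normal_sextic_automorphism[OF L]
  show "Aut (normal_sextic L3 L6) \<subseteq> rho1_Z3 \<zeta>"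
  proof
    fix \<sigma> assume "\<sigma> \<in> Aut (normal_sextic L3 L6)"
    then obtain A where A: "\<sigma> = proj_class A" "aut_matrix (normal_sextic L3 L6) A" by (auto simp: Aut_eq)
    obtain s x where "s \<noteq> 0" "x \<in> cube_roots_one" "A = mat s ** coord_homology x 3"
      using automorphisms_if_not_special[OF N D A(2) no_special] by blast
    moreover from this have "\<sigma> = proj_class (coord_homology x 3)"
      unfolding A(1) proj_class_eq_iff by blast
    ultimately show "\<sigma> \<in> rho1_Z3 \<zeta>"
      by (simp add: rho1_Z3_def pdiag_coord_homology coord_homology_in_generate)
  qed
  have "homogeneous3 6 (normal_sextic L3 L6)"
    using N by (simp add: smooth_plane_curve_def)
  then show "rho1_Z3 \<zeta> \<subseteq> Aut (normal_sextic L3 L6)"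
    unfolding rho1_Z3_def pdiag_coord_homology by (rule generate_subset_Aut) (use D in auto)
qed

lemma Aut_special_sextic:
  assumes "aut_orders_le_3 (special_sextic a b c)" "pairwise_distinct_mod_sign a b c"
  shows "Aut (special_sextic a b c) = rho1_Z3_squared \<zeta>"
proof
  show "Aut (special_sextic a b c) \<subseteq> rho1_Z3_squared \<zeta>"
  proof
    fix \<sigma> assume "\<sigma> \<in> Aut (special_sextic a b c)"
    then obtain A where A: "\<sigma> = proj_class A" "aut_matrix (special_sextic a b c) A" by (auto simp: Aut_eq)
    obtain s x y where s: "s \<noteq> 0" and xy: "x \<in> cube_roots_one" "y \<in> cube_roots_one"
      and A_eq: "A = mat s ** (coord_homology x 2 ** coord_homology y 3)"
      using automorphisms_special_sextic[OF assms A(2)] by blast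
    have "invertible (coord_homology x k)" if "x \<in> cube_roots_one" for x k
      using that zeta_neq_0 by (auto simp: cube_roots_one_def coord_homology_def invertible_diag3_iff)
    moreover have "\<sigma> = proj_class (coord_homology x 2 ** coord_homology y 3)"
      unfolding A(1) proj_class_eq_iff using s A_eq by blast
    ultimately have "\<sigma> = proj_class (coord_homology x 2) \<otimes>\<^bsub>PGL3\<^esub> proj_class (coord_homology y 3)"
      using xy by (simp add: proj_class_mult)
    then show "\<sigma> \<in> rho1_Z3_squared \<zeta>"
      unfolding rho1_Z3_squared_def pdiag_coord_homology
      using xy by (auto intro!: generate.eng coord_homology_in_generate)
  qed
  show "rho1_Z3_squared \<zeta> \<subseteq> Aut (special_sextic a b c)"
    unfolding rho1_Z3_squared_def pdiag_coord_homology
    using homogeneous3_special_sextic coord_homology_special_sextic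
    by (intro generate_subset_Aut) auto
qed

lemma homology_normal_form:
  assumes F: "smooth_plane_curve 6 F" "aut_orders_le_3 F"
    and \<sigma>: "\<sigma> \<in> Aut F" "is_homology \<zeta> \<sigma>"
  shows "\<exists>L3 L6. binary_form_XY 3 L3 \<and> binary_form_XY 6 L6 \<and> L3 \<noteq> 0 \<and> L6 \<noteq> 0
            \<and> K_isomorphic F (normal_sextic L3 L6)"
proof -
  obtain \<tau> where \<tau>: "\<tau> \<in> carrier PGL3"
    and \<sigma>_eq: "\<sigma> = \<tau> \<otimes>\<^bsub>PGL3\<^esub> pdiag 1 \<zeta> \<otimes>\<^bsub>PGL3\<^esub> inv\<^bsub>PGL3\<^esub> \<tau>"
    using \<sigma>(2) by (auto simp: is_homology_def)
  obtain T where T: "\<tau> = proj_class T" "invertible T"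
    using \<tau> by (auto simp: carrier_PGL3)
  then obtain Q where Q: "T ** Q = mat 1" "Q ** T = mat 1"
    by (auto simp: invertible_def)
  then have "invertible Q" by (auto simp: invertible_def)
  have D: "invertible (coord_homology \<zeta> 3)"
    using zeta_neq_0 by (simp add: coord_homology_def invertible_diag3_iff)
  have "\<sigma> = proj_class (T ** coord_homology \<zeta> 3 ** Q)"
    using T D \<open>invertible Q\<close>
    by (simp add: \<sigma>_eq pdiag_coord_homology inv_proj_class[OF Q(1)] proj_class_mult invertible_mult)
  moreover obtain A where A: "\<sigma> = proj_class A" "aut_matrix F A"
    using \<sigma>(1) by (auto simp: Aut_eq)
  \<comment> \<open>Equal classes determine the matrix only up to s; homogeneity makes scalar
    matrices automorphisms, so s can be absorbed.\<close>
  ultimately obtain s where s: "s \<noteq> 0" "T ** coord_homology \<zeta> 3 ** Q = mat s ** A"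
    by (metis proj_class_eq_iff)
  have "homogeneous3 6 F" using F by (simp add: smooth_plane_curve_def)
  then have "aut_matrix F (T ** coord_homology \<zeta> 3 ** Q)"
    unfolding s(2) using s(1) A(2) by (intro aut_matrix_mult aut_matrix_scalar)
  then have G: "aut_matrix (Const 1 * lin_subst T F) (coord_homology \<zeta> 3)"
    by (rule aut_matrix_lin_subst) (use Q in simp_all)
  have FG: "K_isomorphic F (Const 1 * lin_subst T F)"
    unfolding K_isomorphic_def using T(2) by (intro exI[of _ T] exI[of _ 1] conjI) simp_all
  show ?thesis
    using normal_form[OF smooth_plane_curve_K_isomorphic[OF F(1) FG] aut_orders_le_3_K_isomorphic[OF F(2) FG] G]
      K_isomorphic_trans[OF FG] by blast
qed

end

theorem theorem2p4:
  fixes F :: "'a::alg_closed_field poly3" and \<zeta> :: 'a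
  assumes "CHAR('a) = 0 \<or> CHAR('a) > 21"
    and "primitive_root_of_unity 3 \<zeta>"
    and "smooth_plane_curve 6 F"
    and "\<exists>\<sigma>\<in>Aut F. is_homology \<zeta> \<sigma>"
    and "\<forall>\<sigma>\<in>Aut F. 1 \<le> group.ord PGL3 \<sigma> \<and> group.ord PGL3 \<sigma> \<le> 3"
  shows "(\<exists>L3 L6. binary_form_XY 3 L3 \<and> binary_form_XY 6 L6 \<and> L3 \<noteq> 0 \<and> L6 \<noteq> 0
            \<and> K_isomorphic F (normal_sextic L3 L6))
    \<and> (\<forall>L3 L6. binary_form_XY 3 L3 \<and> binary_form_XY 6 L6 \<and> L3 \<noteq> 0 \<and> L6 \<noteq> 0
            \<and> K_isomorphic F (normal_sextic L3 L6)
            \<and> \<not> (\<exists>\<alpha>30 \<alpha>03 \<alpha>33. pairwise_distinct_mod_sign \<alpha>30 \<alpha>03 \<alpha>33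
                  \<and> K_isomorphic F (special_sextic \<alpha>30 \<alpha>03 \<alpha>33))
          \<longrightarrow> Aut (normal_sextic L3 L6) = rho1_Z3 \<zeta>)
    \<and> (\<forall>\<alpha>30 \<alpha>03 \<alpha>33. pairwise_distinct_mod_sign \<alpha>30 \<alpha>03 \<alpha>33
            \<and> K_isomorphic F (special_sextic \<alpha>30 \<alpha>03 \<alpha>33)
          \<longrightarrow> Aut (special_sextic \<alpha>30 \<alpha>03 \<alpha>33) = rho1_Z3_squared \<zeta>)"
proof -
  have "of_nat 2 \<noteq> (0::'a)" "of_nat 3 \<noteq> (0::'a)"
    unfolding of_nat_eq_0_iff_char_dvd using assms(1) by (auto dest: dvd_imp_le)
  then interpret cube_root \<zeta>
    using assms(2) by unfold_locales simp_all
  have F: "aut_orders_le_3 F"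
    using assms(5) by (rule aut_orders_le_3I)
  show ?thesis
  proof (intro conjI allI impI; (elim conjE)?)
    show "\<exists>L3 L6. binary_form_XY 3 L3 \<and> binary_form_XY 6 L6 \<and> L3 \<noteq> 0 \<and> L6 \<noteq> 0
            \<and> K_isomorphic F (normal_sextic L3 L6)"
      using assms(4) homology_normal_form[OF assms(3) F] by blast
  next
    fix L3 L6 :: "'a poly3"
    assume L: "binary_form_XY 3 L3" "binary_form_XY 6 L6" and FN: "K_isomorphic F (normal_sextic L3 L6)"
      and no: "\<not> (\<exists>\<alpha>30 \<alpha>03 \<alpha>33. pairwise_distinct_mod_sign \<alpha>30 \<alpha>03 \<alpha>33
                  \<and> K_isomorphic F (special_sextic \<alpha>30 \<alpha>03 \<alpha>33))"
    \<comment> \<open>The order bound passes to every isomorphic special sextic and makes its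
      parameters distinct modulo sign. Excluding the special sextics with distinct parameters
      therefore excludes all of them.\<close>
    have "\<not> K_isomorphic (normal_sextic L3 L6) (special_sextic a b c)" for a b c
      using no K_isomorphic_trans[OF FN] special_sextic_pairwise_distinct aut_orders_le_3_K_isomorphic[OF F]
      by blast
    then show "Aut (normal_sextic L3 L6) = rho1_Z3 \<zeta>"
      using Aut_normal_sextic[OF smooth_plane_curve_K_isomorphic[OF assms(3) FN]
          aut_orders_le_3_K_isomorphic[OF F FN] L] by blast
  next
    fix a b c :: 'a
    assume "pairwise_distinct_mod_sign a b c" "K_isomorphic F (special_sextic a b c)"
    then show "Aut (special_sextic a b c) = rho1_Z3_squared \<zeta>"
      using Aut_special_sextic aut_orders_le_3_K_isomorphic[OF F] by blast
  qed
qed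

end
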